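(* Let $\mathcal{F}=\{(\Omega_n,K_n,\pi_n)\mid n=1,2,\dots\}$ be a family of irreducible and positive recurrent Markov chains on countable state spaces. For $\delta\in(0,1)$ let $\mathcal{F}_\delta$ be the family of associated $\delta$-lazy walks, and let $\mathcal{F}_c$ be the family of associated continuous time semigroups. Let $(t_n)$, $(b_n)$ be sequences of positive reals with $t_n\to\infty$. Then the following are equivalent: (1) $\mathcal{F}_c$ has a $(t_n,b_n)$ cutoff in total variation. (2) For every $\delta\in(0,1)$, $\mathcal{F}_\delta$ has a $(t_n/(1-\delta),b_n)$ cutoff in total variation.
   Context: A triple $(\Omega,K,\pi)$ consists of a countable set $\Omega$, a transition (stochastic) matrix $K$ on $\Omega$, and its stationary probability distribution $\pi$. For $\delta\in(0,1)$ the $\delta$-lazy walk is the discrete time chain with matrix $K_\delta=\delta I+(1-\delta)K$, and the associated continuous time semigroup is $H_t=e^{-t(I-K)}=\sum_{i\ge0}e^{-t}\frac{t^i}{i!}K^i$, $t\ge0$. Total variation: $\|\mu-\nu\|_{\mathrm{TV}}=\sup_{A\subset\Omega}\{\mu(A)-\nu(A)\}$. Set $$d^{(\delta)}_{\mathrm{TV}}(m)=\sup_{x\in\Omega}\|K_\delta^m(x,\cdot)-\pi\|_{\mathrm{TV}}\ (m\in\{0,1,2,\dots\}),\qquad d^{(c)}_{\mathrm{TV}}(t)=\sup_{x\in\Omega}\|H_t(x,\cdot)-\pi\|_{\mathrm{TV}}\ (t\in[0,\infty)),$$ $T^{(\delta)}_{\mathrm{TV}}(\epsilon)=\inf\{m\in\mathbb{Z}_{\ge0}: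 d^{(\delta)}_{\mathrm{TV}}(m)\le\epsilon\}$ and $T^{(c)}_{\mathrm{TV}}(\epsilon)=\inf\{t\ge0: d^{(c)}_{\mathrm{TV}}(t)\le\epsilon\}$ (with $\inf\emptyset=\infty$). A subscript $n$ refers to the $n$-th chain of the family. A family with mixing times $T_{n,\mathrm{TV}}$ has a $(t_n,b_n)$ cutoff in total variation if $b_n=o(t_n)$ and $|T_{n,\mathrm{TV}}(\epsilon)-t_n|=O(b_n)$ for every $\epsilon\in(0,1)$. Here $s_n=O(b_n)$ means there are $C,N>0$ with $|s_n|\le C|b_n|$ for all $n\ge N$ (the constants may depend on $\epsilon$). This is applied with $T^{(\delta)}_{n,\mathrm{TV}}$ for $\mathcal{F}_\delta$ and with $T^{(c)}_{n,\mathrm{TV}}$ for $\mathcal{F}_c$. *)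

theory Defs
  imports "HOL-Analysis.Analysis" "HOL-Library.Landau_Symbols"
begin

text \<open>Chains live on a countable subset \<open>\<Omega>\<close> of the ambient type, so that the members of a
  family may have different state spaces. A matrix is a function of its row and column index of
  which only the values on \<open>\<Omega> \<times> \<Omega>\<close> are meaningful.\<close>

definition transition_matrix :: "'a set \<Rightarrow> ('a \<Rightarrow> 'a \<Rightarrow> real) \<Rightarrow> bool" where
  "transition_matrix \<Omega> K \<longleftrightarrow>
     (\<forall>x\<in>\<Omega>. (\<forall>y\<in>\<Omega>. 0 \<le> K x y) \<and> ((\<lambda>y. K x y) has_sum 1) \<Omega>)"

definition prob_distribution :: "'a set \<Rightarrow> ('a \<Rightarrow> real) \<Rightarrow> bool" where
  "prob_distribution \<Omega> \<mu> \<longleftrightarrow> (\<forall>x\<in>\<Omega>. 0 \<le> \<mu> x) \<and> (\<mu> has_sum 1) \<Omega>"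

definition stationary_distribution ::
    "'a set \<Rightarrow> ('a \<Rightarrow> 'a \<Rightarrow> real) \<Rightarrow> ('a \<Rightarrow> real) \<Rightarrow> bool" where
  "stationary_distribution \<Omega> K \<pi> \<longleftrightarrow>
     prob_distribution \<Omega> \<pi> \<and> (\<forall>y\<in>\<Omega>. ((\<lambda>x. \<pi> x * K x y) has_sum \<pi> y) \<Omega>)"

definition id_matrix :: "'a \<Rightarrow> 'a \<Rightarrow> real" where
  "id_matrix x y = (if x = y then 1 else 0)"

primrec matrix_pow :: "'a set \<Rightarrow> ('a \<Rightarrow> 'a \<Rightarrow> real) \<Rightarrow> nat \<Rightarrow> 'a \<Rightarrow> 'a \<Rightarrow> real" where
  "matrix_pow \<Omega> K 0 = id_matrix"
| "matrix_pow \<Omega> K (Suc m) = (\<lambda>x y. \<Sum>\<^sub>\<infinity>z\<in>\<Omega>. K x z * matrix_pow \<Omega> K m z y)"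

definition irreducible_chain :: "'a set \<Rightarrow> ('a \<Rightarrow> 'a \<Rightarrow> real) \<Rightarrow> bool" where
  "irreducible_chain \<Omega> K \<longleftrightarrow> (\<forall>x\<in>\<Omega>. \<forall>y\<in>\<Omega>. \<exists>m. 0 < matrix_pow \<Omega> K m x y)"

text \<open>\<open>first_passage \<Omega> K y m x\<close> is the probability that the chain started at \<open>x\<close> visits \<open>y\<close>
  at a positive time for the first time at time \<open>m\<close>.\<close>

fun first_passage :: "'a set \<Rightarrow> ('a \<Rightarrow> 'a \<Rightarrow> real) \<Rightarrow> 'a \<Rightarrow> nat \<Rightarrow> 'a \<Rightarrow> real" where
  "first_passage \<Omega> K y 0 x = 0"
| "first_passage \<Omega> K y (Suc 0) x = K x y"
| "first_passage \<Omega> K y (Suc (Suc m)) x =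
     (\<Sum>\<^sub>\<infinity>z\<in>\<Omega> - {y}. K x z * first_passage \<Omega> K y (Suc m) z)"

text \<open>Every state is recurrent (the return time is almost surely finite) and its return time
  has finite expectation.\<close>

definition positive_recurrent :: "'a set \<Rightarrow> ('a \<Rightarrow> 'a \<Rightarrow> real) \<Rightarrow> bool" where
  "positive_recurrent \<Omega> K \<longleftrightarrow>
     (\<forall>x\<in>\<Omega>. (\<lambda>m. first_passage \<Omega> K x m x) sums 1 \<and>
             summable (\<lambda>m. real m * first_passage \<Omega> K x m x))"

definition lazy_matrix :: "real \<Rightarrow> ('a \<Rightarrow> 'a \<Rightarrow> real) \<Rightarrow> 'a \<Rightarrow> 'a \<Rightarrow> real" where
  "lazy_matrix \<delta> K x y = \<delta> * id_matrix x y + (1 - \<delta>) * K x y"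

definition semigroup_matrix :: "'a set \<Rightarrow> ('a \<Rightarrow> 'a \<Rightarrow> real) \<Rightarrow> real \<Rightarrow> 'a \<Rightarrow> 'a \<Rightarrow> real" where
  "semigroup_matrix \<Omega> K t x y = (\<Sum>i. exp (- t) * (t ^ i / fact i) * matrix_pow \<Omega> K i x y)"

definition tv_dist :: "'a set \<Rightarrow> ('a \<Rightarrow> real) \<Rightarrow> ('a \<Rightarrow> real) \<Rightarrow> real" where
  "tv_dist \<Omega> \<mu> \<nu> = (SUP A\<in>Pow \<Omega>. (\<Sum>\<^sub>\<infinity>x\<in>A. \<mu> x) - (\<Sum>\<^sub>\<infinity>x\<in>A. \<nu> x))"

definition d_lazy ::
    "'a set \<Rightarrow> ('a \<Rightarrow> 'a \<Rightarrow> real) \<Rightarrow> ('a \<Rightarrow> real) \<Rightarrow> real \<Rightarrow> nat \<Rightarrow> real" where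
  "d_lazy \<Omega> K \<pi> \<delta> m = (SUP x\<in>\<Omega>. tv_dist \<Omega> (matrix_pow \<Omega> (lazy_matrix \<delta> K) m x) \<pi>)"

definition d_cont ::
    "'a set \<Rightarrow> ('a \<Rightarrow> 'a \<Rightarrow> real) \<Rightarrow> ('a \<Rightarrow> real) \<Rightarrow> real \<Rightarrow> real" where
  "d_cont \<Omega> K \<pi> t = (SUP x\<in>\<Omega>. tv_dist \<Omega> (semigroup_matrix \<Omega> K t x) \<pi>)"

text \<open>Mixing times are extended reals; the infimum of the empty set is \<open>\<infinity>\<close>.\<close>

definition T_lazy ::
    "'a set \<Rightarrow> ('a \<Rightarrow> 'a \<Rightarrow> real) \<Rightarrow> ('a \<Rightarrow> real) \<Rightarrow> real \<Rightarrow> real \<Rightarrow> ereal" where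
  "T_lazy \<Omega> K \<pi> \<delta> \<epsilon> = (INF m\<in>{m::nat. d_lazy \<Omega> K \<pi> \<delta> m \<le> \<epsilon>}. ereal (real m))"

definition T_cont ::
    "'a set \<Rightarrow> ('a \<Rightarrow> 'a \<Rightarrow> real) \<Rightarrow> ('a \<Rightarrow> real) \<Rightarrow> real \<Rightarrow> ereal" where
  "T_cont \<Omega> K \<pi> \<epsilon> = (INF t\<in>{t::real. 0 \<le> t \<and> d_cont \<Omega> K \<pi> t \<le> \<epsilon>}. ereal t)"

text \<open>\<open>T n \<epsilon>\<close> is the mixing time of the \<open>n\<close>-th member of the family. The \<open>O(b\<^sub>n)\<close> bound is
  spelled out because \<open>T n \<epsilon>\<close> may be infinite; the bound excludes this for large \<open>n\<close>.\<close>

definition has_cutoff ::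
    "(nat \<Rightarrow> real \<Rightarrow> ereal) \<Rightarrow> (nat \<Rightarrow> real) \<Rightarrow> (nat \<Rightarrow> real) \<Rightarrow> bool" where
  "has_cutoff T t b \<longleftrightarrow> b \<in> o(t) \<and>
     (\<forall>\<epsilon>\<in>{0<..<1}. \<exists>C>0. \<exists>N>0. \<forall>n\<ge>N. \<bar>T n \<epsilon> - ereal (t n)\<bar> \<le> ereal (C * \<bar>b n\<bar>))"

end

theory Submission
  imports Defs "HOL-Complex_Analysis.Complex_Analysis"
begin

text \<open>
  Fix \<open>x\<close> and \<open>A\<close> and put \<open>f i = K\<^sup>i(x,A)\<close>, a sequence in \<open>[0,1]\<close>. With \<open>p = 1 - \<delta>\<close> the lazy walk after
  \<open>m\<close> steps is in \<open>A\<close> with the \<^emph>\<open>binomial\<close> average of \<open>f\<close> (parameters \<open>m\<close>, \<open>p\<close>) as its probability, the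
  continuous time chain at time \<open>t\<close> with the \<^emph>\<open>Poisson\<close> average. The two laws have the same mean if
  \<open>t = p m\<close>, but they are not close in total variation, so the theorem is not a matter of comparing
  them. What makes it true is that the binomial average at \<open>(m, p)\<close> is a rapidly convergent combination
  of the derivatives of the Poisson average at the single time \<open>t = p m\<close>.

  In terms of the difference operator \<open>D\<close> on sequences, Poisson averaging evaluates \<open>exp (t D)\<close> at index
  \<open>0\<close>, its \<open>k\<close>-th derivative evaluates \<open>D\<^sup>k exp (t D)\<close>, and binomial averaging evaluates \<open>(1 + p D)\<^sup>m\<close>.
  Hence the coefficients of the expansion are those of \<open>((1 + p z) exp (- p z))\<^sup>m\<close>. Two estimates play
  together. Since \<open>|(1 + z) exp (- z)| \<le> exp (|z|\<^sup>2 / 2)\<close> on the whole complex plane, Cauchy's inequality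
  bounds the coefficients; and since the derivatives of a Poisson average are the inner products of \<open>f\<close>
  with the orthogonal Charlier polynomials, the \<open>k\<close>-th one is at most
  \<open>sqrt (k! / t\<^sup>k)\<close> times the \<open>L\<^sup>2\<close> norm of \<open>f\<close>. The product of the two bounds is of order
  \<open>k p\<^bsup>k/2\<^esup>\<close>, \<^emph>\<open>uniformly in\<close> \<open>m\<close> (lemma \<open>expansion_term_le\<close>). Three consequences follow.

  \<^item> Binomial and Poisson averages differ by \<open>O(sqrt p)\<close> (\<open>bin_avg_close_pois_avg\<close>), which is small if
    \<open>\<delta>\<close> is close to \<open>1\<close>. This settles the implication from the lazy walks to the semigroup, because
    the cutoff of the lazy walks is available for every \<open>\<delta>\<close>.
  \<^item> The binomial average of a sequence \<open>0 \<le> g \<le> 1\<close> is at most a constant times the square root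
    of its Poisson average. Applied to \<open>1 - f\<close>, this shows that the lazy walk is nearly as far from
    \<open>\<pi>\<close> as possible whenever the semigroup is (\<open>d_cont_not_near_one_if_d_lazy\<close>).
  \<^item> If the Poisson averages are small at all times after \<open>t\<close>, so are finitely many of their derivatives,
    by interpolation with the bounds on higher derivatives; the tail of the expansion is small anyway.
    So the lazy walk is close to \<open>\<pi>\<close> whenever the semigroup is (\<open>d_lazy_small_if_d_cont_small\<close>).

  The last two give the implication from the semigroup to the lazy walks. All comparisons are made at
  exactly corresponding times \<open>t = p m\<close>, so the only loss comes from rounding a time to an integer multiple
  of \<open>p\<close>. This is harmless: the distance to \<open>\<pi>\<close> changes slowly with time, so the mixing times for two
  different levels are a constant apart, and the window \<open>b\<close> is bounded away from \<open>0\<close>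
  (\<open>window_bounded_below\<close>).
\<close>

section \<open>Poisson averages of sequences\<close>

definition fdiff :: "(nat \<Rightarrow> real) \<Rightarrow> nat \<Rightarrow> real" where
  "fdiff f i = f (Suc i) - f i"

text \<open>Expectation of \<open>f\<close> at a Poisson variable with mean \<open>t\<close>. Negative \<open>t\<close>, where this is only a power
  series, occur in the bound for the Taylor remainder.\<close>

definition pois_avg :: "(nat \<Rightarrow> real) \<Rightarrow> real \<Rightarrow> real" where
  "pois_avg f t = (\<Sum>i. exp (- t) * (t ^ i / fact i) * f i)"

text \<open>A class of sequences for which all Poisson averages converge and which is closed under products. Bounded
  sequences do not suffice, because the Charlier polynomials have to be averaged as well.\<close>

definition geom_growth :: "(nat \<Rightarrow> real) \<Rightarrow> bool" where
  "geom_growth f \<longleftrightarrow> (\<exists>B c. 0 \<le> B \<and> 1 \<le> c \<and> (\<forall>i. \<bar>f i\<bar> \<le> B * c ^ i))"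

lemma geom_growthI: "0 \<le> B \<Longrightarrow> 1 \<le> c \<Longrightarrow> (\<And>i. \<bar>f i\<bar> \<le> B * c ^ i) \<Longrightarrow> geom_growth f"
  unfolding geom_growth_def by blast

lemma geom_growth_bounded: "(\<And>i. \<bar>f i\<bar> \<le> B) \<Longrightarrow> geom_growth f"
  by (rule geom_growthI[of B 1]) (auto intro: order_trans[OF abs_ge_zero])

lemma geom_growth_const [simp]: "geom_growth (\<lambda>i. a)"
  by (rule geom_growth_bounded[of _ "\<bar>a\<bar>"]) simp

lemma geom_growth_mult:
  assumes "geom_growth f" "geom_growth g"
  shows "geom_growth (\<lambda>i. f i * g i)"
proof -
  from assms obtain B c B' c' where *: "0 \<le> B" "1 \<le> c" "\<And>i. \<bar>f i\<bar> \<le> B * c ^ i"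
     "0 \<le> B'" "1 \<le> c'" "\<And>i. \<bar>g i\<bar> \<le> B' * c' ^ i" unfolding geom_growth_def by blast
  show ?thesis
  proof (rule geom_growthI[of "B * B'" "c * c'"])
    show "0 \<le> B * B'" using * by simp
    show "1 \<le> c * c'" using *(2,5) by (metis mult_mono' mult_1 zero_le_one)
    fix i
    have "\<bar>f i\<bar> * \<bar>g i\<bar> \<le> (B * c ^ i) * (B' * c' ^ i)"
      using * by (intro mult_mono) auto
    then show "\<bar>f i * g i\<bar> \<le> B * B' * (c * c') ^ i"
      by (simp add: abs_mult power_mult_distrib mult_ac)
  qed
qed

lemma geom_growth_add:
  assumes "geom_growth f" "geom_growth g"
  shows "geom_growth (\<lambda>i. f i + g i)"
proof -
  from assms obtain B c B' c' where *: "0 \<le> B" "1 \<le> c" "\<And>i. \<bar>f i\<bar> \<le> B * c ^ i"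
     "0 \<le> B'" "1 \<le> c'" "\<And>i. \<bar>g i\<bar> \<le> B' * c' ^ i" unfolding geom_growth_def by blast
  show ?thesis
  proof (rule geom_growthI[of "B + B'" "max c c'"])
    show "0 \<le> B + B'" "1 \<le> max c c'" using * by auto
    fix i
    have "\<bar>f i\<bar> \<le> B * max c c' ^ i" "\<bar>g i\<bar> \<le> B' * max c c' ^ i"
      using * by (auto intro!: order_trans[OF *(3)] order_trans[OF *(6)] mult_left_mono power_mono)
    then show "\<bar>f i + g i\<bar> \<le> (B + B') * max c c' ^ i"
      by (simp add: distrib_right)
  qed
qed

lemma geom_growth_cmult: "geom_growth f \<Longrightarrow> geom_growth (\<lambda>i. a * f i)"
  by (rule geom_growth_mult) auto

lemma geom_growth_minus: "geom_growth f \<Longrightarrow> geom_growth g \<Longrightarrow> geom_growth (\<lambda>i. f i - g i)"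
  using geom_growth_add[of f "\<lambda>i. (-1) * g i"] geom_growth_cmult[of g "-1"] by simp

lemma geom_growth_Suc:
  assumes "geom_growth f" shows "geom_growth (\<lambda>i. f (Suc i))"
proof -
  from assms obtain B c where *: "0 \<le> B" "1 \<le> c" "\<And>i. \<bar>f i\<bar> \<le> B * c ^ i"
    unfolding geom_growth_def by blast
  show ?thesis
    by (rule geom_growthI[of "B * c" c]) (use * in \<open>auto simp: mult.assoc\<close>, use *(3)[of "Suc _"] in simp)
qed

lemma geom_growth_fdiff: "geom_growth f \<Longrightarrow> geom_growth (fdiff f)"
  unfolding fdiff_def by (intro geom_growth_minus geom_growth_Suc)

lemma geom_growth_fdiffs: "geom_growth f \<Longrightarrow> geom_growth ((fdiff ^^ k) f)"
  by (induction k) (auto intro: geom_growth_fdiff)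

lemma summable_exp_series:
  assumes "geom_growth f"
  shows "summable (\<lambda>i. f i / fact i * t ^ i)"
proof -
  from assms obtain B c where *: "0 \<le> B" "1 \<le> c" "\<And>i. \<bar>f i\<bar> \<le> B * c ^ i"
    unfolding geom_growth_def by blast
  have "summable (\<lambda>i. B * (inverse (fact i) * (c * \<bar>t\<bar>) ^ i))"
    by (intro summable_mult summable_exp)
  then show ?thesis
  proof (rule summable_comparison_test'[where N = 0])
    fix i
    have "\<bar>f i\<bar> * \<bar>t\<bar> ^ i \<le> B * c ^ i * \<bar>t\<bar> ^ i"
      by (intro mult_right_mono *) auto
    then show "norm (f i / fact i * t ^ i) \<le> B * (inverse (fact i) * (c * \<bar>t\<bar>) ^ i)"
      by (simp add: abs_mult power_abs field_simps power_mult_distrib)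
  qed
qed

lemma summable_pois_avg:
  assumes "geom_growth f"
  shows "summable (\<lambda>i. exp (- t) * (t ^ i / fact i) * f i)"
  using summable_mult[OF summable_exp_series[OF assms, of t], of "exp (-t)"] by (simp add: field_simps)

lemma pois_avg_series:
  assumes "geom_growth f"
  shows "pois_avg f t = exp (- t) * (\<Sum>i. f i / fact i * t ^ i)"
  unfolding pois_avg_def
  by (subst suminf_mult[symmetric, OF summable_exp_series[OF assms]]) (simp add: field_simps)

lemma pois_avg_0 [simp]: "pois_avg f 0 = f 0"
proof -
  have "(\<Sum>i. exp (- 0) * (0 ^ i / fact i) * f i) = (\<Sum>i\<in>{0}. exp (- 0) * (0 ^ i / fact i) * f i)"
    by (rule suminf_finite) auto
  then show ?thesis by (simp add: pois_avg_def)
qed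

lemma pois_avg_const [simp]: "pois_avg (\<lambda>i. a) t = a"
proof -
  have "(\<lambda>i. inverse (fact i) * t ^ i) sums exp t"
    using exp_converges[of t] by (simp add: scaleR_conv_of_real field_simps)
  from sums_mult[OF this, of "exp (-t) * a"] show ?thesis
    unfolding pois_avg_def by (intro sums_unique[symmetric]) (simp add: field_simps exp_minus)
qed

lemma pois_avg_add:
  assumes "geom_growth f" "geom_growth g"
  shows "pois_avg (\<lambda>i. f i + g i) t = pois_avg f t + pois_avg g t"
  unfolding pois_avg_def distrib_left
  by (rule suminf_add[symmetric]) (intro summable_pois_avg assms)+

lemma pois_avg_diff:
  assumes "geom_growth f" "geom_growth g"
  shows "pois_avg (\<lambda>i. f i - g i) t = pois_avg f t - pois_avg g t"
  unfolding pois_avg_def right_diff_distrib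
  by (rule suminf_diff[symmetric]) (intro summable_pois_avg assms)+

lemma pois_avg_cmult:
  assumes "geom_growth f"
  shows "pois_avg (\<lambda>i. a * f i) t = a * pois_avg f t"
  unfolding pois_avg_def
  by (subst suminf_mult[symmetric, OF summable_pois_avg[OF assms]]) (simp add: mult_ac)

lemma pois_avg_mono:
  assumes "geom_growth f" "geom_growth g" "0 \<le> t" "\<And>i. f i \<le> g i"
  shows "pois_avg f t \<le> pois_avg g t"
  unfolding pois_avg_def
  by (intro suminf_le summable_pois_avg assms mult_left_mono) (use assms in auto)

lemma pois_avg_nonneg:
  assumes "geom_growth f" "0 \<le> t" "\<And>i. 0 \<le> f i"
  shows "0 \<le> pois_avg f t"
  using pois_avg_mono[of "\<lambda>i. 0" f t] assms by simp

lemma abs_pois_avg_le: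
  assumes "0 \<le> t" "\<And>i. \<bar>f i\<bar> \<le> B"
  shows "\<bar>pois_avg f t\<bar> \<le> B"
proof -
  have g: "geom_growth f" using assms(2) by (rule geom_growth_bounded)
  have "f i \<le> B" "- B \<le> f i" for i using assms(2)[of i] by (auto simp: abs_le_iff)
  then have "pois_avg f t \<le> pois_avg (\<lambda>i. B) t" "pois_avg (\<lambda>i. - B) t \<le> pois_avg f t"
    by (intro pois_avg_mono g assms geom_growth_const; simp)+
  then show ?thesis by simp
qed

text \<open>In \<open>exp (- t) (\<Sum>i. f i t\<^sup>i / i!)\<close> differentiation of the series shifts \<open>f\<close> by one index, and the exponential factor
  contributes \<open>- f\<close>.\<close>

lemma has_field_derivative_pois_avg:
  assumes "geom_growth f"
  shows "(pois_avg f has_field_derivative pois_avg (fdiff f) t) (at t)"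
proof -
  let ?c = "\<lambda>i. f i / fact i"
  have "((\<lambda>x. \<Sum>i. ?c i * x ^ i) has_field_derivative (\<Sum>i. diffs ?c i * t ^ i)) (at t)"
    by (rule termdiffs_strong_converges_everywhere) (rule summable_exp_series[OF assms])
  moreover have "diffs ?c i = f (Suc i) / fact i" for i
    unfolding diffs_def fact_Suc by (simp del: of_nat_Suc)
  ultimately have "((\<lambda>x. \<Sum>i. ?c i * x ^ i) has_field_derivative (\<Sum>i. f (Suc i) / fact i * t ^ i)) (at t)"
    by simp
  then have "((\<lambda>x. exp (- x) * (\<Sum>i. ?c i * x ^ i)) has_field_derivative
      (exp (- t) * (\<Sum>i. f (Suc i) / fact i * t ^ i) - exp (- t) * (\<Sum>i. ?c i * t ^ i))) (at t)"
    by (auto intro!: derivative_eq_intros)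
  then show ?thesis
    unfolding fdiff_def
    by (simp add: pois_avg_diff assms geom_growth_Suc
          pois_avg_series[OF assms, abs_def] pois_avg_series[OF geom_growth_Suc[OF assms]])
qed

lemma abs_fdiffs_le:
  assumes "\<And>i. \<bar>f i\<bar> \<le> B"
  shows "\<bar>(fdiff ^^ k) f i\<bar> \<le> 2 ^ k * B"
proof (induction k arbitrary: i)
  case (Suc k)
  show ?case using Suc[of i] Suc[of "Suc i"] by (simp add: fdiff_def)
qed (use assms in auto)


lemma abs_pois_avg_le_exp:
  assumes "\<And>i. \<bar>f i\<bar> \<le> B"
  shows "\<bar>pois_avg f s\<bar> \<le> exp (\<bar>s\<bar> - s) * B"
proof -
  have B: "0 \<le> B" using assms[of 0] by linarith
  have le: "norm (f i / fact i * s ^ i) \<le> B * (inverse (fact i) * \<bar>s\<bar> ^ i)" for i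
    using mult_right_mono[OF assms[of i], of "\<bar>s\<bar> ^ i"] by (simp add: abs_mult power_abs field_simps)
  have sm: "summable (\<lambda>i. B * (inverse (fact i) * \<bar>s\<bar> ^ i))"
    by (intro summable_mult summable_exp)
  have "\<bar>\<Sum>i. f i / fact i * s ^ i\<bar> \<le> (\<Sum>i. B * (inverse (fact i) * \<bar>s\<bar> ^ i))"
    using norm_suminf_le[OF le sm] by simp
  also have "\<dots> = B * exp \<bar>s\<bar>"
    by (subst suminf_mult[OF summable_exp]) (simp add: exp_def scaleR_conv_of_real field_simps)
  finally show ?thesis
    by (subst pois_avg_series[OF geom_growth_bounded[OF assms]])
       (simp add: abs_mult exp_diff exp_minus field_simps)
qed

text \<open>The \<open>k\<close>-th derivative is a Poisson average of \<open>k\<close>-th differences, which are at most \<open>2\<^sup>k B\<close>; this growth is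
  beaten by the factorial in the remainder, so the expansion is valid for every \<open>h\<close>, also for \<open>h = - t\<close>.\<close>

lemma pois_avg_Taylor:
  assumes f: "\<And>i. \<bar>f i\<bar> \<le> B"
  shows "(\<lambda>k. pois_avg ((fdiff ^^ k) f) t * h ^ k / fact k) sums pois_avg f (t + h)"
proof -
  have g: "geom_growth ((fdiff ^^ k) f)" for k
    by (intro geom_growth_fdiffs geom_growth_bounded[OF f])
  have B: "0 \<le> B" using f[of 0] by linarith
  define d where "d k x = pois_avg ((fdiff ^^ k) f) (x + t)" for k x
  have der: "(d k has_field_derivative d (Suc k) x) (at x)" for k x
  proof -
    have "((\<lambda>y. pois_avg ((fdiff ^^ k) f) (y + t)) has_field_derivative
        pois_avg (fdiff ((fdiff ^^ k) f)) (x + t)) (at x)"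
      by (subst DERIV_shift[of "pois_avg ((fdiff ^^ k) f)", symmetric]) (rule has_field_derivative_pois_avg[OF g])
    moreover have "(\<lambda>y. pois_avg ((fdiff ^^ k) f) (y + t)) = d k"
      by (rule ext) (simp only: d_def)
    moreover have "pois_avg (fdiff ((fdiff ^^ k) f)) (x + t) = d (Suc k) x"
      by (simp only: d_def funpow.simps o_apply)
    ultimately show ?thesis by (simp only:)
  qed
  define M where "M = exp (2 * (\<bar>t\<bar> + \<bar>h\<bar>)) * B"
  have bound: "\<bar>d n x\<bar> \<le> M * 2 ^ n" if "\<bar>x\<bar> \<le> \<bar>h\<bar>" for n x
  proof -
    have "\<bar>d n x\<bar> \<le> exp (\<bar>x + t\<bar> - (x + t)) * (2 ^ n * B)"
      unfolding d_def by (intro abs_pois_avg_le_exp abs_fdiffs_le f)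
    also have "\<dots> \<le> exp (2 * (\<bar>t\<bar> + \<bar>h\<bar>)) * (2 ^ n * B)"
      using that B by (intro mult_right_mono) auto
    finally show ?thesis by (simp add: M_def mult_ac)
  qed
  have rem: "\<bar>(\<Sum>k<n. d k 0 * h ^ k / fact k) - d 0 h\<bar> \<le> M * (inverse (fact n) * (2 * \<bar>h\<bar>) ^ n)" for n
  proof -
    obtain x where x: "\<bar>x\<bar> \<le> \<bar>h\<bar>"
      "d 0 h = (\<Sum>m<n. (d m 0 / fact m) * h ^ m) + (d n x / fact n) * h ^ n"
      using Maclaurin_all_le[of d "d 0" h n] der by blast
    have "\<bar>d n x\<bar> * \<bar>h\<bar> ^ n \<le> M * 2 ^ n * \<bar>h\<bar> ^ n"
      by (intro mult_right_mono bound x) auto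
    then have "\<bar>d n x\<bar> * \<bar>h\<bar> ^ n / fact n \<le> M * 2 ^ n * \<bar>h\<bar> ^ n / fact n"
      by (rule divide_right_mono) simp
    moreover have "(\<Sum>k<n. d k 0 * h ^ k / fact k) - d 0 h = - (d n x / fact n * h ^ n)"
      using x(2) by simp
    then have "\<bar>(\<Sum>k<n. d k 0 * h ^ k / fact k) - d 0 h\<bar> = \<bar>d n x\<bar> * \<bar>h\<bar> ^ n / fact n"
      by (simp only: abs_minus_cancel) (simp add: abs_mult power_abs)
    ultimately show ?thesis
      by (simp only: power_mult_distrib divide_inverse mult_ac)
  qed
  have "(\<lambda>n. M * (inverse (fact n) * (2 * \<bar>h\<bar>) ^ n)) \<longlonglongrightarrow> M * 0"
    by (rule tendsto_mult_left[OF summable_LIMSEQ_zero[OF summable_exp]])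
  then have lim: "(\<lambda>n. M * (inverse (fact n) * (2 * \<bar>h\<bar>) ^ n)) \<longlonglongrightarrow> 0" by (simp only: mult_zero_right)
  have "(\<lambda>n. (\<Sum>k<n. d k 0 * h ^ k / fact k) - d 0 h) \<longlonglongrightarrow> 0"
    by (rule Lim_null_comparison[OF always_eventually lim]) (simp only: real_norm_def rem simp_thms)
  then have "(\<lambda>n. \<Sum>k<n. d k 0 * h ^ k / fact k) \<longlonglongrightarrow> d 0 h"
    by (rule LIM_zero_cancel)
  moreover have "d 0 h = pois_avg f (t + h)" "\<And>k. d k 0 = pois_avg ((fdiff ^^ k) f) t"
    by (simp_all add: d_def add.commute)
  ultimately show ?thesis by (simp only: sums_def)
qed

text \<open>Both sides have the same Taylor series in \<open>s\<close>, because averaging commutes with taking differences.\<close>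

lemma pois_avg_semigroup:
  assumes f: "\<And>i. \<bar>f i\<bar> \<le> B" and t: "0 \<le> t"
  shows "pois_avg f (t + s) = pois_avg (\<lambda>j. pois_avg (\<lambda>i. f (i + j)) t) s"
proof -
  define U where "U f j = pois_avg (\<lambda>i. f (i + j)) t" for f :: "nat \<Rightarrow> real" and j
  have shift: "fdiff (U g) = U (fdiff g)" if "\<And>i. \<bar>g i\<bar> \<le> B'" for g B'
  proof
    fix j
    have "geom_growth (\<lambda>i. g (i + j'))" for j' by (rule geom_growth_bounded) (rule that)
    from pois_avg_diff[OF this this, of "Suc j" j t] show "fdiff (U g) j = U (fdiff g) j"
      by (simp add: U_def fdiff_def)
  qed
  have shifts: "(fdiff ^^ k) (U f) = U ((fdiff ^^ k) f)" for k
  proof (induction k)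
    case (Suc k)
    then show ?case using shift[OF abs_fdiffs_le[OF f], of k] by simp
  qed simp
  have "\<bar>U f j\<bar> \<le> B" for j unfolding U_def by (rule abs_pois_avg_le[OF t]) (rule f)
  then have "(\<lambda>k. pois_avg ((fdiff ^^ k) (U f)) 0 * s ^ k / fact k) sums pois_avg (U f) (0 + s)"
    by (rule pois_avg_Taylor)
  moreover have "pois_avg ((fdiff ^^ k) (U f)) 0 = pois_avg ((fdiff ^^ k) f) t" for k
    unfolding shifts by (simp add: U_def)
  ultimately have "(\<lambda>k. pois_avg ((fdiff ^^ k) f) t * s ^ k / fact k) sums pois_avg (U f) s"
    by simp
  with pois_avg_Taylor[where f = f and t = t and h = s, OF f] show ?thesis
    unfolding U_def[abs_def] by (rule sums_unique2)
qed


section \<open>Charlier polynomials and the size of the derivatives\<close>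

text \<open>Charlier polynomials, normalised such that the Poisson weight at \<open>i\<close> times \<open>charlier t k i\<close> is the \<open>k\<close>-th
  derivative of this weight in \<open>t\<close>. At \<open>i = 0\<close> the value at
  the truncated index \<open>i - 1\<close> is multiplied by \<open>0\<close>.\<close>

primrec charlier :: "real \<Rightarrow> nat \<Rightarrow> nat \<Rightarrow> real" where
  "charlier t 0 i = 1"
| "charlier t (Suc k) i = real i / t * charlier t k (i - 1) - charlier t k i"

lemma abs_charlier_le:
  assumes "0 < t"
  shows "\<bar>charlier t k i\<bar> \<le> (1 + real i / t) ^ k"
proof (induction k arbitrary: i)
  case (Suc k)
  have "\<bar>charlier t k (i - 1)\<bar> \<le> (1 + real (i - 1) / t) ^ k" by (rule Suc)
  also have "\<dots> \<le> (1 + real i / t) ^ k"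
    using assms by (intro power_mono) (auto simp: divide_right_mono)
  finally have "real i / t * \<bar>charlier t k (i - 1)\<bar> \<le> real i / t * (1 + real i / t) ^ k"
    using assms by (intro mult_left_mono) auto
  moreover have "\<bar>charlier t (Suc k) i\<bar> \<le> real i / t * \<bar>charlier t k (i - 1)\<bar> + \<bar>charlier t k i\<bar>"
    using assms by (simp add: abs_mult abs_diff_triangle_ineq order_trans[OF abs_triangle_ineq4])
  ultimately show ?case using Suc[of i] by (simp add: algebra_simps)
qed auto

lemma geom_growth_charlier [simp]:
  assumes "0 < t" shows "geom_growth (charlier t k)"
proof (rule geom_growthI[of 1 "exp (real k / t)"])
  fix i
  have "\<bar>charlier t k i\<bar> \<le> (1 + real i / t) ^ k" by (rule abs_charlier_le[OF assms])
  also have "\<dots> \<le> exp (real i / t) ^ k"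
    using assms by (intro power_mono) auto
  also have "\<dots> = 1 * exp (real k / t) ^ i"
    by (simp add: exp_of_nat_mult[symmetric] mult.commute)
  finally show "\<bar>charlier t k i\<bar> \<le> 1 * exp (real k / t) ^ i" .
qed (use assms in auto)

lemma fdiff_charlier:
  assumes "0 < t"
  shows "fdiff (charlier t (Suc k)) i = real (Suc k) / t * charlier t k i"
proof (induction k arbitrary: i)
  case (Suc k)
  have *: "real i * charlier t (Suc k) i = real i * (charlier t (Suc k) (i - 1) + real (Suc k) / t * charlier t k (i - 1))"
  proof (cases i)
    case i: (Suc j)
    have "charlier t (Suc k) i = charlier t (Suc k) (i - 1) + real (Suc k) / t * charlier t k (i - 1)"
      using Suc.IH[of j] unfolding fdiff_def i by (simp del: charlier.simps)
    then show ?thesis by (simp only:)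
  qed simp
  have c: "charlier t (Suc (Suc k)) i = real i / t * charlier t (Suc k) (i - 1) - charlier t (Suc k) i"
    "charlier t (Suc (Suc k)) (Suc i) = real (Suc i) / t * charlier t (Suc k) i - charlier t (Suc k) (Suc i)"
    by (simp_all only: charlier.simps(2)[of t "Suc k"] diff_Suc_1)
  have "fdiff (charlier t (Suc (Suc k))) i
     = (real (Suc i) * charlier t (Suc k) i - real i * charlier t (Suc k) (i - 1)) / t - fdiff (charlier t (Suc k)) i"
    unfolding fdiff_def c by (simp add: diff_divide_distrib del: charlier.simps)
  also have "\<dots> = (charlier t (Suc k) i + real (Suc k) / t * (real i * charlier t k (i - 1))) / t - real (Suc k) / t * charlier t k i"
    using * unfolding Suc by (simp add: algebra_simps del: charlier.simps)
  also have "\<dots> = charlier t (Suc k) i / t + real (Suc k) / t * charlier t (Suc k) i"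
    using assms by (simp add: field_simps)
  finally show ?case using assms by (simp add: field_simps del: charlier.simps)
qed (use assms in \<open>simp add: fdiff_def field_simps\<close>)

text \<open>The identity \<open>i t\<^sup>i / i! = t t\<^bsup>i-1\<^esup> / (i-1)!\<close> for the weights; it is what makes summation by parts work
  below.\<close>

lemma pois_avg_size_bias:
  assumes "geom_growth h"
  shows "pois_avg (\<lambda>i. real i * h (i - 1)) t = t * pois_avg h t"
proof -
  let ?a = "\<lambda>i. exp (- t) * (t ^ i / fact i) * (real i * h (i - 1))"
  have eq: "?a (Suc i) = t * (exp (- t) * (t ^ i / fact i) * h i)" for i
    unfolding fact_Suc by (simp del: of_nat_Suc)
  have "(\<lambda>i. ?a (Suc i)) sums (t * pois_avg h t)"
    unfolding eq pois_avg_def by (intro sums_mult summable_sums summable_pois_avg assms)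
  then have "?a sums (t * pois_avg h t)" by (subst (asm) sums_Suc_iff) simp
  then show ?thesis unfolding pois_avg_def by (simp add: sums_iff)
qed

text \<open>Summation by parts against the Poisson weights.\<close>

lemma pois_avg_charlier_Suc:
  assumes t: "0 < t" and g: "geom_growth g"
  shows "pois_avg (\<lambda>i. charlier t (Suc k) i * g i) t = pois_avg (\<lambda>i. charlier t k i * fdiff g i) t"
proof -
  let ?h = "\<lambda>i. charlier t k i * g (Suc i)"
  have h: "geom_growth ?h" by (intro geom_growth_mult geom_growth_Suc g geom_growth_charlier t)
  have cg: "geom_growth (\<lambda>i. charlier t k i * g i)" by (intro geom_growth_mult g geom_growth_charlier t)
  have c1g: "geom_growth (\<lambda>i. charlier t (Suc k) i * g i)" by (intro geom_growth_mult g geom_growth_charlier t)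
  have eq: "(\<lambda>i. real i * ?h (i - 1)) = (\<lambda>i. t * (charlier t (Suc k) i * g i + charlier t k i * g i))"
  proof
    fix i show "real i * ?h (i - 1) = t * (charlier t (Suc k) i * g i + charlier t k i * g i)"
      using t by (cases i) (auto simp: field_simps)
  qed
  have "t * pois_avg ?h t = t * (pois_avg (\<lambda>i. charlier t (Suc k) i * g i) t + pois_avg (\<lambda>i. charlier t k i * g i) t)"
    unfolding pois_avg_size_bias[OF h, symmetric] eq
    by (simp add: pois_avg_cmult pois_avg_add geom_growth_add cg c1g del: charlier.simps)
  then have "pois_avg (\<lambda>i. charlier t (Suc k) i * g i) t = pois_avg ?h t - pois_avg (\<lambda>i. charlier t k i * g i) t"
    using t by simp
  also have "\<dots> = pois_avg (\<lambda>i. charlier t k i * fdiff g i) t"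
    unfolding fdiff_def right_diff_distrib by (rule pois_avg_diff[symmetric]) (intro h cg)+
  finally show ?thesis .
qed

lemma pois_avg_charlier:
  assumes "0 < t" "geom_growth g"
  shows "pois_avg (\<lambda>i. charlier t k i * g i) t = pois_avg ((fdiff ^^ k) g) t"
  using assms(2)
proof (induction k arbitrary: g)
  case (Suc k)
  then show ?case
    using pois_avg_charlier_Suc[OF assms(1), of g k] by (simp add: geom_growth_fdiff funpow_swap1 del: charlier.simps)
qed simp

text \<open>Summation by parts removes one degree from the first factor and puts a difference on the second, which
  lowers its degree too and produces the factor \<open>k / t\<close>.\<close>

lemma pois_avg_charlier_sq:
  assumes "0 < t"
  shows "pois_avg (\<lambda>i. charlier t k i * charlier t k i) t = fact k / t ^ k"
proof (induction k)
  case (Suc k)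
  have "pois_avg (\<lambda>i. charlier t (Suc k) i * charlier t (Suc k) i) t
     = pois_avg (\<lambda>i. real (Suc k) / t * (charlier t k i * charlier t k i)) t"
    by (subst pois_avg_charlier_Suc) (use assms in \<open>simp_all add: fdiff_charlier mult_ac del: charlier.simps\<close>)
  also have "\<dots> = real (Suc k) / t * (fact k / t ^ k)"
    by (subst pois_avg_cmult) (use assms Suc in \<open>auto intro: geom_growth_mult\<close>)
  finally show ?case using assms by (simp add: field_simps)
qed simp

text \<open>The left side is the squared inner product of \<open>g\<close> with the \<open>k\<close>-th Charlier polynomial, so this is the
  Cauchy-Schwarz inequality in the \<open>L\<^sup>2\<close> space of the Poisson law.\<close>

lemma pois_avg_fdiffs_sq_le:
  assumes t: "0 < t" and g: "geom_growth g"
  shows "(pois_avg ((fdiff ^^ k) g) t)\<^sup>2 \<le> fact k / t ^ k * pois_avg (\<lambda>i. (g i)\<^sup>2) t"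
proof -
  let ?c = "charlier t k"
  define N where "N = fact k / t ^ k"
  define F where "F = pois_avg (\<lambda>i. ?c i * g i) t"
  have N: "0 < N" using t by (simp add: N_def)
  have gg: "geom_growth (\<lambda>i. (g i)\<^sup>2)" "geom_growth (\<lambda>i. ?c i * g i)" "geom_growth (\<lambda>i. ?c i * ?c i)"
    unfolding power2_eq_square by (intro geom_growth_mult g geom_growth_charlier t)+
  let ?l = "F / N"
  have "0 \<le> pois_avg (\<lambda>i. (g i - ?l * ?c i)\<^sup>2) t"
    unfolding power2_eq_square
    by (intro pois_avg_nonneg geom_growth_mult geom_growth_minus geom_growth_cmult g geom_growth_charlier t)
       (use t in auto)
  also have "(\<lambda>i. (g i - ?l * ?c i)\<^sup>2) = (\<lambda>i. (g i)\<^sup>2 - ((2 * ?l) * (?c i * g i) - ?l\<^sup>2 * (?c i * ?c i)))"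
    by (auto simp: power2_eq_square algebra_simps)
  also have "pois_avg \<dots> t = pois_avg (\<lambda>i. (g i)\<^sup>2) t - (2 * ?l * F - ?l\<^sup>2 * N)"
    by (simp only: pois_avg_diff geom_growth_minus geom_growth_cmult pois_avg_cmult gg
          pois_avg_charlier_sq[OF t] F_def[symmetric] N_def[symmetric])
  also have "2 * ?l * F - ?l\<^sup>2 * N = F\<^sup>2 / N"
    using N by (simp add: power2_eq_square field_simps)
  finally have "F\<^sup>2 \<le> N * pois_avg (\<lambda>i. (g i)\<^sup>2) t" using N by (simp add: field_simps)
  then show ?thesis by (simp add: F_def N_def pois_avg_charlier[OF t g])
qed

section \<open>Coefficients of the quotient of binomial and Poisson generating functions\<close>

text \<open>Coefficient of \<open>z\<^sup>k\<close> in \<open>((1 + z) exp (- z))\<^sup>m\<close>.\<close>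

definition ratio_coeff :: "nat \<Rightarrow> nat \<Rightarrow> real" where
  "ratio_coeff m k = (\<Sum>j\<le>k. real (m choose j) * (- real m) ^ (k - j) / fact (k - j))"

lemma ratio_coeff_0 [simp]: "ratio_coeff m 0 = 1"
  by (simp add: ratio_coeff_def)

text \<open>From \<open>|1 + z|\<^sup>2 = 1 + (2 Re z + |z|\<^sup>2) \<le> exp (2 Re z + |z|\<^sup>2)\<close>. The linear term of the exponent cancels; only
  the quadratic one survives, as for a Gaussian.\<close>

lemma norm_one_plus_times_exp_le: "norm ((1 + z) * exp (- z)) \<le> exp ((norm z)\<^sup>2 / 2)" for z :: complex
proof -
  have "(norm (1 + z))\<^sup>2 = 1 + (2 * Re z + (norm z)\<^sup>2)"
    by (simp add: cmod_power2 power2_sum)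
  moreover have "(norm (exp (- z)))\<^sup>2 = exp (- 2 * Re z)"
    using exp_double[of "- Re z"] by simp
  ultimately have "(norm ((1 + z) * exp (- z)))\<^sup>2 = (1 + (2 * Re z + (norm z)\<^sup>2)) * exp (- 2 * Re z)"
    by (simp only: norm_mult power_mult_distrib)
  also have "\<dots> \<le> exp (2 * Re z + (norm z)\<^sup>2) * exp (- 2 * Re z)"
    by (intro mult_right_mono exp_ge_add_one_self) auto
  also have "\<dots> = (exp ((norm z)\<^sup>2 / 2))\<^sup>2"
    by (simp add: exp_add[symmetric] exp_double[symmetric])
  finally show ?thesis by (rule power2_le_imp_le) simp
qed

lemma has_fps_expansion_ratio:
  "(\<lambda>z::complex. ((1 + z) * exp (- z)) ^ m) has_fps_expansion Abs_fps (\<lambda>k. of_real (ratio_coeff m k))"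
proof -
  have "(\<lambda>z::complex. (1 + z) ^ m * exp (- of_nat m * z)) has_fps_expansion
      (1 + fps_X) ^ m * fps_exp (- of_nat m)"
    by (intro fps_expansion_intros)
  also have "(\<lambda>z::complex. (1 + z) ^ m * exp (- of_nat m * z)) = (\<lambda>z. ((1 + z) * exp (- z)) ^ m)"
    by (simp add: power_mult_distrib exp_of_nat_mult[symmetric])
  also have "(1 + fps_X) ^ m * fps_exp (- of_nat m) = Abs_fps (\<lambda>k. complex_of_real (ratio_coeff m k))"
  proof (rule fps_ext)
    fix k
    have "((1 + fps_X) ^ m :: complex fps) $ j = of_nat (m choose j)" for j
      unfolding fps_binomial_of_nat[symmetric] by (simp add: fps_binomial_nth binomial_gbinomial)
    then show "((1 + fps_X) ^ m * fps_exp (- of_nat m)) $ k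
        = Abs_fps (\<lambda>k. complex_of_real (ratio_coeff m k)) $ k"
      by (simp add: fps_mult_nth ratio_coeff_def atLeast0AtMost)
  qed
  finally show ?thesis .
qed

text \<open>Cauchy's inequality on the circle of radius \<open>sqrt (k / m)\<close>, which minimises \<open>exp (m r\<^sup>2 / 2) / r\<^sup>k\<close>.\<close>

lemma ratio_coeff_sq_le:
  assumes "0 < k" "0 < m"
  shows "(ratio_coeff m k)\<^sup>2 \<le> exp (real k) * (real m / real k) ^ k"
proof -
  let ?g = "\<lambda>z::complex. ((1 + z) * exp (- z)) ^ m"
  define r where "r = sqrt (real k / real m)"
  have r: "0 < r" "r\<^sup>2 = real k / real m" using assms by (auto simp: r_def)
  define E where "E = exp (real m * r\<^sup>2 / 2)"
  have "norm ((deriv ^^ k) ?g 0) \<le> fact k * E / r ^ k"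
  proof (rule Cauchy_inequality)
    fix z :: complex assume "norm (0 - z) = r"
    then have "norm ((1 + z) * exp (- z)) ^ m \<le> exp (r\<^sup>2 / 2) ^ m"
      using norm_one_plus_times_exp_le[of z] by (intro power_mono) auto
    then show "norm (?g z) \<le> E"
      by (simp add: norm_power E_def exp_of_nat_mult[symmetric])
  qed (use r in \<open>auto intro!: holomorphic_intros continuous_intros\<close>)
  moreover have "of_real (ratio_coeff m k) = (deriv ^^ k) ?g 0 / fact k"
    using fps_nth_fps_expansion[OF has_fps_expansion_ratio[of m], of k] by simp
  then have "\<bar>ratio_coeff m k\<bar> = norm ((deriv ^^ k) ?g 0) / fact k"
    by (metis norm_of_real norm_divide norm_fact)
  ultimately have "\<bar>ratio_coeff m k\<bar> \<le> E / r ^ k"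
    by (simp add: divide_le_eq mult.commute)
  then have "\<bar>ratio_coeff m k\<bar>\<^sup>2 \<le> (E / r ^ k)\<^sup>2" by (intro power_mono) auto
  also have "\<dots> = exp (real m * r\<^sup>2) / (r\<^sup>2) ^ k"
    by (simp add: E_def power_divide exp_double[symmetric] power_mult[symmetric] mult.commute)
  also have "\<dots> = exp (real k) * (real m / real k) ^ k"
    unfolding r(2) using assms by (simp add: power_divide)
  finally show ?thesis by simp
qed

text \<open>The induction step is \<open>e \<le> (1 + 1/k)\<^bsup>k+1\<^esup>\<close>. A factor \<open>k\<close> in place of the
  \<open>sqrt k\<close> of Stirling's formula is good enough, since it will meet a geometric sequence.\<close>

lemma fact_le_power_exp:
  assumes "0 < k"
  shows "exp (real k) * fact k \<le> exp 1 * real k * real k ^ k"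
  using assms
proof (induction k rule: nat_induct_non_zero)
  case (Suc k)
  have "real k / real (Suc k) \<le> exp (real k / real (Suc k) - 1)"
    using exp_ge_add_one_self[of "real k / real (Suc k) - 1"] by simp
  also have "real k / real (Suc k) - 1 = - 1 / real (Suc k)"
    by (simp add: field_simps)
  finally have "(real k / real (Suc k)) ^ Suc k \<le> exp (- 1 / real (Suc k)) ^ Suc k"
    by (intro power_mono) auto
  also have "\<dots> = exp (- 1)"
    by (subst exp_of_nat_mult[symmetric]) simp
  finally have *: "exp 1 * real k ^ Suc k \<le> real (Suc k) ^ Suc k"
    by (simp add: power_divide divide_le_eq exp_minus field_simps del: power_Suc of_nat_Suc)
  have "exp (real (Suc k)) * fact (Suc k) = exp 1 * real (Suc k) * (exp (real k) * fact k)"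
    by (simp add: exp_add algebra_simps)
  also have "\<dots> \<le> exp 1 * real (Suc k) * (exp 1 * real k * real k ^ k)"
    by (intro mult_left_mono Suc) auto
  also have "\<dots> = exp 1 * real (Suc k) * (exp 1 * real k ^ Suc k)" by simp
  also have "\<dots> \<le> exp 1 * real (Suc k) * real (Suc k) ^ Suc k"
    by (intro mult_left_mono *) auto
  finally show ?case .
qed simp

section \<open>Binomial averages in terms of Poisson averages\<close>

text \<open>Expectation of \<open>f\<close> at a binomial variable, computed by conditioning on the first of the \<open>m\<close> trials. This
  is how a step of the lazy walk acts.\<close>

primrec bin_avg :: "real \<Rightarrow> nat \<Rightarrow> (nat \<Rightarrow> real) \<Rightarrow> real" where
  "bin_avg p 0 f = f 0"
| "bin_avg p (Suc m) f = (1 - p) * bin_avg p m f + p * bin_avg p m (\<lambda>i. f (Suc i))"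

lemma bin_avg_diff: "bin_avg p m (\<lambda>i. f i - g i) = bin_avg p m f - bin_avg p m g"
proof (induction m arbitrary: f g)
  case (Suc m)
  show ?case by (simp add: Suc) (simp add: algebra_simps)
qed simp

lemma bin_avg_const [simp]: "bin_avg p m (\<lambda>i. a) = a"
  by (induction m) (simp_all add: algebra_simps)

lemma bin_avg_mono:
  assumes "0 \<le> p" "p \<le> 1" "\<And>i. f i \<le> g i"
  shows "bin_avg p m f \<le> bin_avg p m g"
  using assms(3)
proof (induction m arbitrary: f g)
  case (Suc m)
  have "bin_avg p m f \<le> bin_avg p m g" "bin_avg p m (\<lambda>i. f (Suc i)) \<le> bin_avg p m (\<lambda>i. g (Suc i))"
    by (rule Suc.IH, rule Suc.prems)+
  then show ?case unfolding bin_avg.simps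
    using assms(1,2) by (intro add_mono mult_left_mono) simp_all
qed simp

lemma abs_bin_avg_le:
  assumes "0 \<le> p" "p \<le> 1" "\<And>i. \<bar>f i\<bar> \<le> B"
  shows "\<bar>bin_avg p m f\<bar> \<le> B"
proof -
  have "f i \<le> B" "- B \<le> f i" for i using assms(3)[of i] by (auto simp: abs_le_iff)
  then have "bin_avg p m f \<le> bin_avg p m (\<lambda>i. B)" "bin_avg p m (\<lambda>i. - B) \<le> bin_avg p m f"
    using bin_avg_mono[OF assms(1,2), of f "\<lambda>i. B"] bin_avg_mono[OF assms(1,2), of "\<lambda>i. - B" f] by blast+
  then show ?thesis by simp
qed

lemma bin_avg_Suc_fdiff: "bin_avg p (Suc m) f = bin_avg p m f + p * bin_avg p m (fdiff f)"
  unfolding fdiff_def[abs_def] by (simp add: bin_avg_diff algebra_simps)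

text \<open>\<open>(1 + p D)\<^sup>m\<close> by the binomial theorem, with \<open>D\<close> the difference operator.\<close>

lemma bin_avg_eq_fdiffs:
  "bin_avg p m f = (\<Sum>j\<le>m. real (m choose j) * p ^ j * (fdiff ^^ j) f 0)"
proof (induction m arbitrary: f)
  case (Suc m)
  let ?a = "\<lambda>j. p ^ j * (fdiff ^^ j) f 0"
  have "(\<Sum>j\<le>m. real (m choose j) * ?a j) = (\<Sum>j\<le>Suc m. real (m choose j) * ?a j)" by simp
  also have "\<dots> = ?a 0 + (\<Sum>j\<le>m. real (m choose Suc j) * ?a (Suc j))"
    by (subst sum.atMost_Suc_shift) simp
  finally have *: "(\<Sum>j\<le>m. real (m choose j) * ?a j) = ?a 0 + (\<Sum>j\<le>m. real (m choose Suc j) * ?a (Suc j))" .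
  have "p * bin_avg p m (fdiff f) = (\<Sum>j\<le>m. real (m choose j) * ?a (Suc j))"
    unfolding Suc by (simp add: sum_distrib_left funpow_swap1 mult_ac)
  moreover have "bin_avg p m f = (\<Sum>j\<le>m. real (m choose j) * ?a j)"
    unfolding Suc by (simp add: mult_ac)
  ultimately have "bin_avg p (Suc m) f
     = ?a 0 + (\<Sum>j\<le>m. real (m choose Suc j) * ?a (Suc j)) + (\<Sum>j\<le>m. real (m choose j) * ?a (Suc j))"
    unfolding bin_avg_Suc_fdiff * by simp
  also have "\<dots> = ?a 0 + (\<Sum>j\<le>m. real (Suc m choose Suc j) * ?a (Suc j))"
    by (simp add: sum.distrib[symmetric] distrib_right add.commute)
  also have "\<dots> = (\<Sum>j\<le>Suc m. real (Suc m choose j) * ?a j)"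
    by (subst sum.atMost_Suc_shift) simp
  finally show ?case by (simp only: mult.assoc)
qed simp

text \<open>By the previous lemma it is enough to expand the differences of \<open>f\<close> at index \<open>0\<close>. These are Poisson averages
  with mean \<open>0\<close>, hence given by the Taylor series around \<open>t\<close> with increment \<open>- t\<close>. Since only finitely many
  differences occur, collecting equal derivatives amounts to adding finitely many shifted series.\<close>

lemma bin_avg_expansion:
  fixes f :: "nat \<Rightarrow> real" and m :: nat and p :: real
  assumes f: "\<And>i. \<bar>f i\<bar> \<le> B"
  defines "t \<equiv> p * real m"
  shows "(\<lambda>k. p ^ k * ratio_coeff m k * pois_avg ((fdiff ^^ k) f) t) sums bin_avg p m f"
proof -
  define F where "F k = pois_avg ((fdiff ^^ k) f) t" for k
  define X where "X j k = p ^ j * (- t) ^ (k - j) / fact (k - j) * F k" for j k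
  have 1: "(\<lambda>k. if j \<le> k then X j k else 0) sums (p ^ j * (fdiff ^^ j) f 0)" for j
  proof -
    have "(\<lambda>i. pois_avg ((fdiff ^^ i) ((fdiff ^^ j) f)) t * (- t) ^ i / fact i)
        sums pois_avg ((fdiff ^^ j) f) (t + - t)"
      by (rule pois_avg_Taylor) (rule abs_fdiffs_le[OF f])
    then have "(\<lambda>i. p ^ j * (F (i + j) * (- t) ^ i / fact i)) sums (p ^ j * (fdiff ^^ j) f 0)"
      by (intro sums_mult) (simp add: F_def funpow_add)
    then have "(\<lambda>i. if j \<le> i + j then X j (i + j) else 0) sums (p ^ j * (fdiff ^^ j) f 0)"
      by (simp add: X_def mult_ac)
    then show ?thesis
      by (subst (asm) sums_zero_iff_shift) auto
  qed
  have "(\<lambda>k. \<Sum>j\<le>m. real (m choose j) * (if j \<le> k then X j k else 0))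
      sums (\<Sum>j\<le>m. real (m choose j) * (p ^ j * (fdiff ^^ j) f 0))"
    by (intro sums_sum sums_mult 1)
  moreover have "(\<Sum>j\<le>m. real (m choose j) * (if j \<le> k then X j k else 0))
     = p ^ k * ratio_coeff m k * F k" for k
  proof -
    have "(\<Sum>j\<le>m. real (m choose j) * (if j \<le> k then X j k else 0))
        = (\<Sum>j\<in>{..m} \<inter> {..k}. real (m choose j) * X j k)"
      by (subst sum.inter_restrict) (auto intro!: sum.cong)
    also have "\<dots> = (\<Sum>j\<le>k. real (m choose j) * X j k)"
      by (rule sum.mono_neutral_left) auto
    also have "\<dots> = (\<Sum>j\<le>k. p ^ k * (real (m choose j) * (- real m) ^ (k - j) / fact (k - j)) * F k)"
    proof (rule sum.cong)
      fix j assume "j \<in> {..k}"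
      then have "p ^ k = p ^ j * p ^ (k - j)" by (simp add: power_add[symmetric])
      moreover have "(- t) ^ (k - j) = p ^ (k - j) * (- real m) ^ (k - j)"
        by (simp add: t_def power_mult_distrib[symmetric])
      ultimately show "real (m choose j) * X j k =
          p ^ k * (real (m choose j) * (- real m) ^ (k - j) / fact (k - j)) * F k"
        by (simp add: X_def)
    qed simp
    also have "\<dots> = p ^ k * ratio_coeff m k * F k"
      by (simp add: ratio_coeff_def sum_distrib_left sum_distrib_right)
    finally show ?thesis .
  qed
  ultimately show ?thesis by (simp add: bin_avg_eq_fdiffs F_def mult.assoc)
qed

text \<open>Bound for the \<open>k\<close>-th term of the expansion when \<open>f\<close> has \<open>L\<^sup>2\<close> norm \<open>1\<close>. It does not depend on \<open>m\<close>, which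
  is the point of the whole estimate.\<close>

definition weight :: "real \<Rightarrow> nat \<Rightarrow> real" where
  "weight p k = (if k = 0 then 1 else exp 1 * real k * sqrt p ^ k)"

lemma weight_nonneg: "0 < p \<Longrightarrow> 0 \<le> weight p k"
  by (simp add: weight_def)

lemma weight_sums:
  assumes "0 < p" "p < 1"
  shows "(\<lambda>k. weight p (Suc k)) sums (exp 1 * sqrt p / (1 - sqrt p)\<^sup>2)"
proof -
  have "(\<lambda>k. of_nat (Suc k) * sqrt p ^ k) sums (1 / (1 - sqrt p)\<^sup>2)"
    using assms by (intro geometric_deriv_sums) simp
  from sums_mult[OF this, of "exp 1 * sqrt p"] show ?thesis
    by (simp add: weight_def mult_ac del: of_nat_Suc)
qed

lemma coeff_le_weight:
  assumes "0 < p" "0 < m"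
  shows "\<bar>p ^ k * ratio_coeff m k\<bar> \<le> weight p k * sqrt ((p * real m) ^ k / fact k)"
proof (cases "k = 0")
  case False
  have "(p ^ k * ratio_coeff m k)\<^sup>2 \<le> (p ^ k)\<^sup>2 * (exp (real k) * (real m / real k) ^ k)"
    unfolding power_mult_distrib
    using assms False by (intro mult_left_mono ratio_coeff_sq_le) auto
  also have "\<dots> = (p ^ k * (p * real m) ^ k / (fact k * real k ^ k)) * (exp (real k) * fact k)"
    by (simp add: power2_eq_square power_mult_distrib power_divide)
  also have "\<dots> \<le> (p ^ k * (p * real m) ^ k / (fact k * real k ^ k)) * (exp 1 * real k * real k ^ k)"
    using assms False by (intro mult_left_mono fact_le_power_exp) auto
  also have "\<dots> = (p ^ k * (p * real m) ^ k / fact k) * (exp 1 * real k)"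
    using False by simp
  also have "\<dots> \<le> (p ^ k * (p * real m) ^ k / fact k) * (exp 1 * real k)\<^sup>2"
  proof (intro mult_left_mono)
    have "1 \<le> exp 1 * real k"
      using False mult_mono[of 1 "exp 1" 1 "real k"] by simp
    then show "exp 1 * real k \<le> (exp 1 * real k)\<^sup>2"
      unfolding power2_eq_square by (simp add: mult_le_cancel_left1)
  qed (use assms in auto)
  also have "\<dots> = (weight p k * sqrt ((p * real m) ^ k / fact k))\<^sup>2"
    using assms False
    by (simp add: weight_def power_mult_distrib real_sqrt_pow2 power_mult[symmetric] mult.commute[of k 2])
       (simp add: power_mult)
  finally show ?thesis
    using assms by (subst abs_le_square_iff[THEN iffD2, THEN order_trans]) (auto simp: weight_nonneg abs_mult)
qed (simp add: weight_def)

text \<open>The factors \<open>sqrt ((p m)\<^sup>k / k!)\<close> and \<open>sqrt (k! / t\<^sup>k)\<close> in the bounds for the coefficient and for the derivative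
  cancel exactly.\<close>

lemma expansion_term_le:
  assumes "0 < p" "0 < m" "geom_growth f"
  defines "t \<equiv> p * real m"
  shows "\<bar>p ^ k * ratio_coeff m k * pois_avg ((fdiff ^^ k) f) t\<bar> \<le> weight p k * sqrt (pois_avg (\<lambda>i. (f i)\<^sup>2) t)"
proof -
  have t: "0 < t" using assms by simp
  let ?F = "pois_avg ((fdiff ^^ k) f) t" and ?Q = "pois_avg (\<lambda>i. (f i)\<^sup>2) t"
  have "\<bar>?F\<bar> \<le> sqrt (fact k / t ^ k * ?Q)"
    using pois_avg_fdiffs_sq_le[OF t assms(3), of k] by (metis real_sqrt_abs real_sqrt_le_iff)
  then have "\<bar>p ^ k * ratio_coeff m k\<bar> * \<bar>?F\<bar>
      \<le> (weight p k * sqrt (t ^ k / fact k)) * sqrt (fact k / t ^ k * ?Q)"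
    unfolding t_def using assms weight_nonneg[of p k]
    by (intro mult_mono coeff_le_weight) auto
  also have "\<dots> = weight p k * sqrt ((t ^ k / fact k) * (fact k / t ^ k * ?Q))"
    by (simp add: real_sqrt_mult real_sqrt_divide)
  also have "(t ^ k / fact k) * (fact k / t ^ k * ?Q) = ?Q" using t by simp
  finally show ?thesis by (simp add: abs_mult)
qed

text \<open>The term for \<open>k = 0\<close> of the expansion is the Poisson average itself.\<close>

lemma bin_avg_close_pois_avg:
  assumes p: "0 < p" "p < 1" and f: "\<And>i. \<bar>f i\<bar> \<le> B"
  shows "\<bar>bin_avg p m f - pois_avg f (p * real m)\<bar>
     \<le> exp 1 * sqrt p / (1 - sqrt p)\<^sup>2 * sqrt (pois_avg (\<lambda>i. (f i)\<^sup>2) (p * real m))"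
    (is "_ \<le> ?E * sqrt ?Q")
proof (cases "m = 0")
  case False
  let ?T = "\<lambda>k. p ^ k * ratio_coeff m k * pois_avg ((fdiff ^^ k) f) (p * real m)"
  have "?T sums bin_avg p m f" by (rule bin_avg_expansion[OF f])
  then have 1: "(\<lambda>k. ?T (Suc k)) sums (bin_avg p m f - pois_avg f (p * real m))"
    using sums_Suc_iff[of ?T "bin_avg p m f - pois_avg f (p * real m)"] by simp
  have 2: "(\<lambda>k. weight p (Suc k) * sqrt ?Q) sums (?E * sqrt ?Q)"
    by (intro sums_mult2 weight_sums p)
  have "norm (\<Sum>k. ?T (Suc k)) \<le> (\<Sum>k. weight p (Suc k) * sqrt ?Q)"
    using False p geom_growth_bounded[OF f] sums_summable[OF 2]
    by (intro norm_suminf_le) (auto intro!: expansion_term_le simp del: power_Suc funpow.simps)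
  then show ?thesis using sums_unique[OF 1] sums_unique[OF 2] by simp
qed (use p in auto)

text \<open>Landau's inequality: if \<open>\<phi>\<close> is small and \<open>\<phi>''\<close> is bounded on a half-line, then \<open>\<phi>'\<close> is small. It is applied
  repeatedly, to the derivatives measured in the natural scale \<open>sqrt t\<close>, where the \<open>k\<close>-th of them is bounded by
  \<open>sqrt (k!)\<close> for any \<open>t\<close>.\<close>

lemma pois_avg_derivatives_small:
  assumes "0 < \<epsilon>"
  shows "\<exists>\<eta>>0. \<forall>f t. (\<forall>i. \<bar>f i\<bar> \<le> 1) \<longrightarrow> 0 < t \<longrightarrow> (\<forall>s\<ge>t. \<bar>pois_avg f s\<bar> \<le> \<eta>) \<longrightarrow>
    (\<forall>s\<ge>t. \<bar>pois_avg ((fdiff ^^ k) f) s\<bar> * sqrt t ^ k \<le> \<epsilon>)"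
  using assms
proof (induction k arbitrary: \<epsilon>)
  case 0
  then show ?case by (intro exI[of _ \<epsilon>]) auto
next
  case (Suc k)
  define C where "C = sqrt (fact (k + 2))"
  have C: "0 < C" by (simp add: C_def)
  \<comment> \<open>Expanding over a step \<open>h = \<kappa> sqrt t\<close> bounds the next derivative by \<open>2 M / \<kappa> + \<kappa> C / 2\<close>; each part is made \<open>\<epsilon> / 2\<close>.\<close>
  define \<kappa> where "\<kappa> = \<epsilon> / C"
  have \<kappa>: "0 < \<kappa>" using Suc.prems C by (simp add: \<kappa>_def)
  define M where "M = \<epsilon> * \<kappa> / 4"
  have M: "0 < M" using Suc.prems \<kappa> by (simp add: M_def)
  obtain \<eta> where \<eta>: "\<eta> > 0" and IH: "\<And>f t s. (\<forall>i. \<bar>f i\<bar> \<le> 1) \<Longrightarrow> 0 < t \<Longrightarrow> (\<forall>s\<ge>t. \<bar>pois_avg f s\<bar> \<le> \<eta>) \<Longrightarrow>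
      s \<ge> t \<Longrightarrow> \<bar>pois_avg ((fdiff ^^ k) f) s\<bar> * sqrt t ^ k \<le> M"
    using Suc.IH[OF M] by blast
  show ?case
  proof (intro exI[of _ \<eta>] conjI allI impI \<eta>)
    fix f :: "nat \<Rightarrow> real" and t s :: real
    assume f: "\<forall>i. \<bar>f i\<bar> \<le> 1" and t: "0 < t" and small: "\<forall>s\<ge>t. \<bar>pois_avg f s\<bar> \<le> \<eta>" and s: "t \<le> s"
    define \<phi> where "\<phi> j x = pois_avg ((fdiff ^^ j) f) x" for j x
    have g: "geom_growth ((fdiff ^^ j) f)" for j
      using f by (intro geom_growth_fdiffs geom_growth_bounded[of f 1]) auto
    have der: "(\<phi> j has_field_derivative \<phi> (Suc j) x) (at x)" for j x
      using has_field_derivative_pois_avg[OF g[of j]] by (simp add: \<phi>_def[abs_def])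
    define h where "h = \<kappa> * sqrt t"
    have h: "0 < h" using \<kappa> t by (simp add: h_def)
    obtain \<xi> where \<xi>: "\<xi> > s" and T: "\<phi> k (s + h) = (\<Sum>j<2. \<phi> (k + j) s / fact j * (s + h - s) ^ j)
        + \<phi> (k + 2) \<xi> / fact 2 * (s + h - s) ^ 2"
      using Taylor_up[of 2 "\<lambda>j. \<phi> (k + j)" "\<phi> k" s "s + h" s] der h by auto
    have eq: "h * \<phi> (Suc k) s = \<phi> k (s + h) - \<phi> k s - h\<^sup>2 / 2 * \<phi> (k + 2) \<xi>"
      using T by (simp add: numeral_2_eq_2)
    let ?q = "sqrt t"
    have b1: "\<bar>\<phi> k x\<bar> * ?q ^ k \<le> M" if "t \<le> x" for x
      unfolding \<phi>_def using IH[OF f t small that] .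
    have b2: "\<bar>\<phi> (k + 2) \<xi>\<bar> * ?q ^ (k + 2) \<le> C"
    proof -
      have "(\<phi> (k + 2) \<xi>)\<^sup>2 \<le> fact (k + 2) / \<xi> ^ (k + 2) * pois_avg (\<lambda>i. (f i)\<^sup>2) \<xi>"
        unfolding \<phi>_def using \<xi> s t g[of 0] by (intro pois_avg_fdiffs_sq_le) auto
      also have "\<dots> \<le> fact (k + 2) / t ^ (k + 2) * 1"
      proof (intro mult_mono divide_left_mono power_mono)
        have "\<bar>pois_avg (\<lambda>i. (f i)\<^sup>2) \<xi>\<bar> \<le> 1"
          using \<xi> s t f by (intro abs_pois_avg_le) (auto simp: abs_square_le_1)
        then show "pois_avg (\<lambda>i. (f i)\<^sup>2) \<xi> \<le> 1" by simp
        show "0 \<le> pois_avg (\<lambda>i. (f i)\<^sup>2) \<xi>"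
          using \<xi> s t g[of 0] geom_growth_mult[OF g[of 0] g[of 0]]
          by (intro pois_avg_nonneg) (auto simp: power2_eq_square)
      qed (use \<xi> s t in auto)
      finally have "(\<phi> (k + 2) \<xi>)\<^sup>2 * t ^ (k + 2) \<le> fact (k + 2)"
        using t by (simp add: pos_le_divide_eq del: fact_Suc power_Suc add_2_eq_Suc')
      also have "(\<phi> (k + 2) \<xi>)\<^sup>2 * t ^ (k + 2) = (\<bar>\<phi> (k + 2) \<xi>\<bar> * ?q ^ (k + 2))\<^sup>2"
      proof -
        have "(?q ^ (k + 2))\<^sup>2 = (?q\<^sup>2) ^ (k + 2)"
          by (simp only: power_mult[symmetric] mult.commute)
        also have "?q\<^sup>2 = t" using t by simp
        finally show ?thesis by (simp only: power_mult_distrib power2_abs)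
      qed
      finally show ?thesis unfolding C_def by (rule real_le_rsqrt)
    qed
    have "\<kappa> * (\<bar>\<phi> (Suc k) s\<bar> * ?q ^ Suc k) = \<bar>h * \<phi> (Suc k) s\<bar> * ?q ^ k"
      using h \<kappa> t by (simp add: h_def abs_mult)
    also have "\<dots> \<le> (\<bar>\<phi> k (s + h)\<bar> + \<bar>\<phi> k s\<bar> + h\<^sup>2 / 2 * \<bar>\<phi> (k + 2) \<xi>\<bar>) * ?q ^ k"
    proof (intro mult_right_mono)
      have "\<bar>h\<^sup>2 / 2 * \<phi> (k + 2) \<xi>\<bar> = h\<^sup>2 / 2 * \<bar>\<phi> (k + 2) \<xi>\<bar>" by (simp add: abs_mult)
      then show "\<bar>h * \<phi> (Suc k) s\<bar> \<le> \<bar>\<phi> k (s + h)\<bar> + \<bar>\<phi> k s\<bar> + h\<^sup>2 / 2 * \<bar>\<phi> (k + 2) \<xi>\<bar>"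
        unfolding eq by linarith
    qed (use t in auto)
    also have "\<dots> = \<bar>\<phi> k (s + h)\<bar> * ?q ^ k + \<bar>\<phi> k s\<bar> * ?q ^ k + \<kappa>\<^sup>2 / 2 * (\<bar>\<phi> (k + 2) \<xi>\<bar> * ?q ^ (k + 2))"
      by (simp add: h_def power_mult_distrib power_add algebra_simps power2_eq_square)
    also have "\<dots> \<le> M + M + \<kappa>\<^sup>2 / 2 * C"
      using s h by (intro add_mono b1 mult_left_mono b2) auto
    also have "\<dots> = \<kappa> * \<epsilon>"
      using C by (simp add: M_def \<kappa>_def power2_eq_square field_simps)
    finally show "\<bar>pois_avg ((fdiff ^^ Suc k) f) s\<bar> * ?q ^ Suc k \<le> \<epsilon>"
      using \<kappa> by (simp add: \<phi>_def)
  qed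
qed

text \<open>The terms of the expansion from some \<open>R\<close> on are small in total by the bound \<open>weight\<close>, which holds for all \<open>m\<close>
  and \<open>f\<close> at once; the finitely many others are small by interpolation.\<close>

lemma bin_avg_small:
  assumes p: "0 < p" "p < 1" and \<epsilon>: "0 < \<epsilon>"
  shows "\<exists>\<eta>>0. \<forall>m f. (\<forall>i. \<bar>f i\<bar> \<le> 1) \<longrightarrow> (\<forall>s\<ge>p * real m. \<bar>pois_avg f s\<bar> \<le> \<eta>) \<longrightarrow> \<bar>bin_avg p m f\<bar> \<le> \<epsilon>"
proof -
  have sw: "summable (weight p)"
    using sums_summable[OF weight_sums[OF p]] summable_Suc_iff by blast
  have w0: "0 \<le> weight p k" for k using p weight_nonneg by simp
  obtain R where "\<forall>n\<ge>R. norm (\<Sum>k. weight p (k + n)) < \<epsilon> / 2"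
    using suminf_exist_split[OF _ sw, of "\<epsilon> / 2"] \<epsilon> by auto
  then have R: "(\<Sum>k. weight p (k + R)) < \<epsilon> / 2"
    using abs_ge_self[of "\<Sum>k. weight p (k + R)"] by (force simp del: abs_ge_self)
  define W where "W = (\<Sum>k<R. weight p k)"
  have W: "0 \<le> W" unfolding W_def by (intro sum_nonneg w0)
  define \<epsilon>' where "\<epsilon>' = \<epsilon> / (2 * (W + 1))"
  have \<epsilon>': "0 < \<epsilon>'" using \<epsilon> W by (simp add: \<epsilon>'_def)
  have "\<forall>k. \<exists>\<eta>>0. \<forall>f t. (\<forall>i. \<bar>f i\<bar> \<le> 1) \<longrightarrow> 0 < t \<longrightarrow> (\<forall>s\<ge>t. \<bar>pois_avg f s\<bar> \<le> \<eta>) \<longrightarrow>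
    (\<forall>s\<ge>t. \<bar>pois_avg ((fdiff ^^ k) f) s\<bar> * sqrt t ^ k \<le> \<epsilon>')"
    using pois_avg_derivatives_small[OF \<epsilon>'] by blast
  then obtain e where e: "\<And>k. e k > 0" and small: "\<And>k f t s. (\<forall>i. \<bar>f i\<bar> \<le> 1) \<Longrightarrow> 0 < t \<Longrightarrow> (\<forall>s\<ge>t. \<bar>pois_avg f s\<bar> \<le> e k) \<Longrightarrow>
     s \<ge> t \<Longrightarrow> \<bar>pois_avg ((fdiff ^^ k) f) s\<bar> * sqrt t ^ k \<le> \<epsilon>'" by metis
  define \<eta> where "\<eta> = Min (insert \<epsilon> (e ` {..<R}))"
  have \<eta>: "0 < \<eta>" "\<eta> \<le> \<epsilon>" "\<And>k. k < R \<Longrightarrow> \<eta> \<le> e k"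
    unfolding \<eta>_def using \<epsilon> e by auto
  show ?thesis
  proof (intro exI[of _ \<eta>] conjI allI impI \<eta>(1))
    fix m :: nat and f :: "nat \<Rightarrow> real"
    assume f: "\<forall>i. \<bar>f i\<bar> \<le> 1" and s: "\<forall>s\<ge>p * real m. \<bar>pois_avg f s\<bar> \<le> \<eta>"
    show "\<bar>bin_avg p m f\<bar> \<le> \<epsilon>"
    proof (cases "m = 0")
      case True
      then show ?thesis using s[rule_format, of 0] \<eta>(2) by simp
    next
      case False
      define t where "t = p * real m"
      have t: "0 < t" using p False by (simp add: t_def)
      have g: "geom_growth f" using f by (intro geom_growth_bounded[of f 1]) auto
      let ?T = "\<lambda>k. p ^ k * ratio_coeff m k * pois_avg ((fdiff ^^ k) f) t"
      have sT: "?T sums bin_avg p m f"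
        unfolding t_def using f by (intro bin_avg_expansion[of f 1]) auto
      have Q: "pois_avg (\<lambda>i. (f i)\<^sup>2) t \<le> 1"
        using abs_pois_avg_le[of t "\<lambda>i. (f i)\<^sup>2" 1] t f by (simp add: abs_square_le_1)
      have T1: "\<bar>?T k\<bar> \<le> weight p k" for k
      proof -
        have "\<bar>?T k\<bar> \<le> weight p k * sqrt (pois_avg (\<lambda>i. (f i)\<^sup>2) t)"
          unfolding t_def using p False g by (intro expansion_term_le) auto
        also have "\<dots> \<le> weight p k * 1"
          using Q w0 by (intro mult_left_mono) auto
        finally show ?thesis by simp
      qed
      have T2: "\<bar>?T k\<bar> \<le> weight p k * \<epsilon>'" if "k < R" for k
      proof -
        have "\<bar>pois_avg ((fdiff ^^ k) f) t\<bar> * sqrt t ^ k \<le> \<epsilon>'"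
          using s \<eta>(3)[OF that] by (intro small[OF f t]) (force simp: t_def)+
        moreover have "sqrt (t ^ k / fact k) \<le> sqrt t ^ k"
        proof -
          have "t ^ k / fact k \<le> t ^ k / 1"
            using t by (intro divide_left_mono) (auto simp: fact_ge_1)
          then show ?thesis by (simp add: real_sqrt_power[symmetric])
        qed
        then have "\<bar>p ^ k * ratio_coeff m k\<bar> \<le> weight p k * sqrt t ^ k"
          using coeff_le_weight[of p m k] p False w0
          by (auto simp: t_def intro: order_trans mult_left_mono)
        then have "\<bar>?T k\<bar> \<le> weight p k * sqrt t ^ k * \<bar>pois_avg ((fdiff ^^ k) f) t\<bar>"
          unfolding abs_mult[of "p ^ k * ratio_coeff m k"] by (intro mult_right_mono) auto
        ultimately show ?thesis
          using mult_left_mono[OF _ w0[of k]] by (smt (verit) mult.assoc mult.commute)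
      qed
      have "bin_avg p m f = (\<Sum>k. ?T (k + R)) + (\<Sum>k<R. ?T k)"
        using sums_unique[OF sT] suminf_split_initial_segment[OF sums_summable[OF sT]] by simp
      moreover have "\<bar>\<Sum>k. ?T (k + R)\<bar> \<le> (\<Sum>k. weight p (k + R))"
        using norm_suminf_le[of "\<lambda>k. ?T (k + R)" "\<lambda>k. weight p (k + R)"] T1 sw by simp
      moreover have "\<bar>\<Sum>k<R. ?T k\<bar> \<le> (\<Sum>k<R. weight p k * \<epsilon>')"
        by (intro order_trans[OF sum_abs] sum_mono T2) auto
      moreover have "(\<Sum>k<R. weight p k * \<epsilon>') \<le> \<epsilon> / 2"
        unfolding sum_distrib_right[symmetric] W_def[symmetric] \<epsilon>'_def
        using W \<epsilon> by (simp add: field_simps)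
      ultimately show ?thesis using R by linarith
    qed
  qed
qed

section \<open>Transition probabilities of lazy walks and semigroups as averages\<close>

text \<open>Tonelli's theorem for sums.\<close>

lemma has_sum_swap_nonneg:
  fixes a :: "'i \<Rightarrow> 'b \<Rightarrow> real"
  assumes nonneg: "\<And>i y. i \<in> I \<Longrightarrow> y \<in> Y \<Longrightarrow> 0 \<le> a i y"
    and row: "\<And>i. i \<in> I \<Longrightarrow> (a i has_sum r i) Y"
    and total: "(r has_sum R) I"
    and column: "\<And>y. y \<in> Y \<Longrightarrow> ((\<lambda>i. a i y) has_sum c y) I"
  shows "(c has_sum R) Y"
proof -
  let ?f = "\<lambda>(i, y). a i y"
  have "?f summable_on I \<times> Y"
    by (rule summable_on_SigmaI[where g = r]) (use row total nonneg in \<open>auto simp: summable_on_def\<close>)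
  then have "(?f has_sum R) (I \<times> Y)"
    by (intro has_sum_SigmaI[where g = r]) (use row total in auto)
  then have "((\<lambda>(y, i). a i y) has_sum R) (Y \<times> I)"
    by (subst (asm) has_sum_swap) simp
  then show ?thesis
    by (rule has_sum_SigmaD) (use column in auto)
qed

lemma has_sum_pois_avg:
  assumes "\<And>i. 0 \<le> f i" "\<And>i. f i \<le> 1" "0 \<le> t"
  shows "((\<lambda>i. exp (- t) * (t ^ i / fact i) * f i) has_sum pois_avg f t) UNIV"
proof (rule sums_nonneg_imp_has_sum)
  have "geom_growth f" by (rule geom_growth_bounded[of f 1]) (use assms in auto)
  then show "(\<lambda>i. exp (- t) * (t ^ i / fact i) * f i) sums pois_avg f t"
    unfolding pois_avg_def by (intro summable_sums summable_pois_avg)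
qed (use assms in simp)

lemma has_sum_bin_avg:
  assumes "\<And>i. ((\<lambda>z. w z * f z i) has_sum r i) \<Omega>"
  shows "((\<lambda>z. w z * bin_avg p m (f z)) has_sum bin_avg p m r) \<Omega>"
  using assms
proof (induction m arbitrary: f r)
  case (Suc m)
  have "((\<lambda>z. (1 - p) * (w z * bin_avg p m (f z)) + p * (w z * bin_avg p m (\<lambda>i. f z (Suc i))))
      has_sum bin_avg p (Suc m) r) \<Omega>"
    unfolding bin_avg.simps by (intro has_sum_add has_sum_cmult_right Suc)
  then show ?case by (simp add: algebra_simps)
qed simp

lemma has_sum_id_matrix:
  assumes "x \<in> \<Omega>"
  shows "((\<lambda>z. id_matrix x z * h z) has_sum h x) \<Omega>"
proof -
  have "((\<lambda>z. id_matrix x z * h z) has_sum (\<Sum>z\<in>{x}. id_matrix x z * h z)) {x}"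
    by (intro has_sum_finite) simp
  then have "((\<lambda>z. id_matrix x z * h z) has_sum (\<Sum>z\<in>{x}. id_matrix x z * h z)) \<Omega>"
    by (subst has_sum_cong_neutral[where T = "{x}" and g = "\<lambda>z. id_matrix x z * h z"]) (use assms in \<open>auto simp: id_matrix_def\<close>)
  then show ?thesis by (simp add: id_matrix_def)
qed

lemma transition_matrix_id: "transition_matrix (\<Omega> :: 'a set) id_matrix"
proof -
  have "(id_matrix x has_sum 1) \<Omega>" if "x \<in> \<Omega>" for x
    using has_sum_id_matrix[OF that, of "\<lambda>_. 1"] by simp
  moreover have "0 \<le> id_matrix x y" for x y :: 'a by (simp add: id_matrix_def)
  ultimately show ?thesis unfolding transition_matrix_def by blast
qed

lemma transition_matrix_lazy:
  assumes "transition_matrix \<Omega> K" "0 \<le> \<delta>" "\<delta> \<le> 1"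
  shows "transition_matrix \<Omega> (lazy_matrix \<delta> K)"
  unfolding transition_matrix_def
proof (intro ballI conjI)
  fix x assume x: "x \<in> \<Omega>"
  have "((\<lambda>y. \<delta> * (id_matrix x y * 1) + (1 - \<delta>) * K x y) has_sum \<delta> * 1 + (1 - \<delta>) * 1) \<Omega>"
    using assms x unfolding transition_matrix_def
    by (intro has_sum_add has_sum_cmult_right has_sum_id_matrix) auto
  then show "(lazy_matrix \<delta> K x has_sum 1) \<Omega>"
    by (simp add: lazy_matrix_def[abs_def])
  fix y assume "y \<in> \<Omega>"
  then show "0 \<le> lazy_matrix \<delta> K x y"
    using assms x by (auto simp: lazy_matrix_def id_matrix_def transition_matrix_def)
qed

lemma transition_matrix_avg_summable:
  assumes K: "transition_matrix \<Omega> K" and x: "x \<in> \<Omega>" and h: "\<And>z. z \<in> \<Omega> \<Longrightarrow> 0 \<le> h z \<and> h z \<le> 1"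
  shows "(\<lambda>z. K x z * h z) summable_on \<Omega>"
proof (rule summable_on_comparison_test)
  show "(\<lambda>z. K x z) summable_on \<Omega>" using K x by (auto simp: transition_matrix_def summable_on_def)
  fix z assume "z \<in> \<Omega>"
  then show "K x z * h z \<le> K x z" "0 \<le> K x z * h z"
    using K x h[of z] by (auto simp: transition_matrix_def intro: mult_left_le)
qed

lemma transition_matrix_row_subset:
  assumes "transition_matrix \<Omega> M" "x \<in> \<Omega>" "A \<subseteq> \<Omega>"
  shows "(M x has_sum infsum (M x) A) A" "0 \<le> infsum (M x) A" "infsum (M x) A \<le> 1"
proof -
  have M: "(M x has_sum 1) \<Omega>" "\<And>y. y \<in> \<Omega> \<Longrightarrow> 0 \<le> M x y"
    using assms by (auto simp: transition_matrix_def)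
  then have s: "M x summable_on A"
    using assms(3) by (meson summable_on_def summable_on_subset_banach)
  then show "(M x has_sum infsum (M x) A) A" by (rule has_sum_infsum)
  show "0 \<le> infsum (M x) A" using M assms(3) by (intro infsum_nonneg) auto
  have "infsum (M x) A \<le> infsum (M x) \<Omega>"
    using M assms(3) s by (intro infsum_mono_neutral) (auto simp: summable_on_def)
  then show "infsum (M x) A \<le> 1" using infsumI[OF M(1)] by simp
qed

lemma transition_matrix_mult_has_sum:
  assumes K: "transition_matrix \<Omega> K" and M: "transition_matrix \<Omega> M" and x: "x \<in> \<Omega>" and A: "A \<subseteq> \<Omega>"
  shows "((\<lambda>y. \<Sum>\<^sub>\<infinity>z\<in>\<Omega>. K x z * M z y) has_sum (\<Sum>\<^sub>\<infinity>z\<in>\<Omega>. K x z * infsum (M z) A)) A"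
proof (rule has_sum_swap_nonneg[where I = \<Omega> and a = "\<lambda>z y. K x z * M z y" and r = "\<lambda>z. K x z * infsum (M z) A"])
  fix z assume z: "z \<in> \<Omega>"
  show "((\<lambda>y. K x z * M z y) has_sum K x z * infsum (M z) A) A"
    by (intro has_sum_cmult_right transition_matrix_row_subset[OF M z A])
  show "0 \<le> K x z * M z y" if "y \<in> A" for y
    using K M x z A that by (auto simp: transition_matrix_def)
next
  show "((\<lambda>z. K x z * infsum (M z) A) has_sum (\<Sum>\<^sub>\<infinity>z\<in>\<Omega>. K x z * infsum (M z) A)) \<Omega>"
    by (intro has_sum_infsum transition_matrix_avg_summable[OF K x] conjI transition_matrix_row_subset[OF M _ A])
next
  fix y assume "y \<in> A"
  then have "{y} \<subseteq> \<Omega>" using A by auto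
  then have "0 \<le> M z y \<and> M z y \<le> 1" if "z \<in> \<Omega>" for z
    using transition_matrix_row_subset[OF M that, of "{y}"] by simp
  then show "((\<lambda>z. K x z * M z y) has_sum (\<Sum>\<^sub>\<infinity>z\<in>\<Omega>. K x z * M z y)) \<Omega>"
    by (intro has_sum_infsum transition_matrix_avg_summable[OF K x])
qed

lemma transition_matrix_pow:
  assumes K: "transition_matrix \<Omega> K"
  shows "transition_matrix \<Omega> (matrix_pow \<Omega> K m)"
proof (induction m)
  case (Suc m)
  show ?case unfolding transition_matrix_def
  proof (intro ballI conjI)
    fix x assume x: "x \<in> \<Omega>"
    have "(\<Sum>\<^sub>\<infinity>z\<in>\<Omega>. K x z * infsum (matrix_pow \<Omega> K m z) \<Omega>) = (\<Sum>\<^sub>\<infinity>z\<in>\<Omega>. K x z)"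
      using Suc by (intro infsum_cong) (auto simp: transition_matrix_def infsumI)
    also have "\<dots> = 1" using K x by (auto simp: transition_matrix_def infsumI)
    finally show "(matrix_pow \<Omega> K (Suc m) x has_sum 1) \<Omega>"
      using transition_matrix_mult_has_sum[OF K Suc x order_refl] by simp
    fix y assume "y \<in> \<Omega>"
    then show "0 \<le> matrix_pow \<Omega> K (Suc m) x y"
      using K Suc x by (auto simp: transition_matrix_def intro!: infsum_nonneg)
  qed
qed (simp add: transition_matrix_id)

definition visit :: "'a set \<Rightarrow> ('a \<Rightarrow> 'a \<Rightarrow> real) \<Rightarrow> 'a set \<Rightarrow> 'a \<Rightarrow> nat \<Rightarrow> real" where
  "visit \<Omega> K A x i = infsum (matrix_pow \<Omega> K i x) A"

text \<open>Conditioning on the first step.\<close>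

lemma visit_Suc_has_sum:
  assumes "transition_matrix \<Omega> K" "x \<in> \<Omega>" "A \<subseteq> \<Omega>"
  shows "((\<lambda>z. K x z * visit \<Omega> K A z i) has_sum visit \<Omega> K A x (Suc i)) \<Omega>"
proof -
  note M = transition_matrix_pow[OF assms(1), of i]
  have "visit \<Omega> K A x (Suc i) = (\<Sum>\<^sub>\<infinity>z\<in>\<Omega>. K x z * visit \<Omega> K A z i)"
    using infsumI[OF transition_matrix_mult_has_sum[OF assms(1) M assms(2,3)]]
    by (simp add: visit_def)
  moreover have "(\<lambda>z. K x z * visit \<Omega> K A z i) summable_on \<Omega>"
    unfolding visit_def
    by (intro transition_matrix_avg_summable assms conjI transition_matrix_row_subset[OF M])
  ultimately show ?thesis by simp
qed

lemma visit_lazy: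
  assumes K: "transition_matrix \<Omega> K" and \<delta>: "0 \<le> \<delta>" "\<delta> \<le> 1" and A: "A \<subseteq> \<Omega>" and x: "x \<in> \<Omega>"
  shows "visit \<Omega> (lazy_matrix \<delta> K) A x m = bin_avg (1 - \<delta>) m (visit \<Omega> K A x)"
  using x
proof (induction m arbitrary: x)
  case 0
  then show ?case by (simp add: visit_def)
next
  case (Suc m)
  let ?b = "\<lambda>z. bin_avg (1 - \<delta>) m (visit \<Omega> K A z)"
  have "((\<lambda>z. lazy_matrix \<delta> K x z * visit \<Omega> (lazy_matrix \<delta> K) A z m) has_sum
      visit \<Omega> (lazy_matrix \<delta> K) A x (Suc m)) \<Omega>"
    by (rule visit_Suc_has_sum[OF transition_matrix_lazy[OF K \<delta>] Suc.prems A])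
  then have 1: "((\<lambda>z. lazy_matrix \<delta> K x z * ?b z) has_sum visit \<Omega> (lazy_matrix \<delta> K) A x (Suc m)) \<Omega>"
    by (subst (asm) has_sum_cong[where g = "\<lambda>z. lazy_matrix \<delta> K x z * ?b z"]) (auto simp: Suc.IH)
  have "((\<lambda>z. \<delta> * (id_matrix x z * ?b z) + (1 - \<delta>) * (K x z * ?b z)) has_sum
      (\<delta> * ?b x + (1 - \<delta>) * bin_avg (1 - \<delta>) m (\<lambda>i. visit \<Omega> K A x (Suc i)))) \<Omega>"
    by (intro has_sum_add has_sum_cmult_right has_sum_id_matrix has_sum_bin_avg visit_Suc_has_sum K A Suc.prems)
  then have "((\<lambda>z. lazy_matrix \<delta> K x z * ?b z) has_sum bin_avg (1 - \<delta>) (Suc m) (visit \<Omega> K A x)) \<Omega>"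
    by (simp add: lazy_matrix_def algebra_simps)
  with 1 show ?case by (rule has_sum_unique)
qed

lemma visit_semigroup:
  assumes K: "transition_matrix \<Omega> K" and t: "0 \<le> t" and A: "A \<subseteq> \<Omega>" and x: "x \<in> \<Omega>"
  shows "infsum (semigroup_matrix \<Omega> K t x) A = pois_avg (visit \<Omega> K A x) t"
proof (rule infsumI, rule has_sum_swap_nonneg[where I = "UNIV :: nat set"])
  note M = transition_matrix_pow[OF K]
  show "((\<lambda>i. exp (- t) * (t ^ i / fact i) * visit \<Omega> K A x i) has_sum pois_avg (visit \<Omega> K A x) t) UNIV"
    unfolding visit_def using transition_matrix_row_subset[OF M x A] t by (intro has_sum_pois_avg) auto
  show "((\<lambda>y. exp (- t) * (t ^ i / fact i) * matrix_pow \<Omega> K i x y) has_sum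
      exp (- t) * (t ^ i / fact i) * visit \<Omega> K A x i) A" for i
    unfolding visit_def by (intro has_sum_cmult_right transition_matrix_row_subset[OF M x A])
  fix y assume "y \<in> A"
  then have y: "y \<in> \<Omega>" "{y} \<subseteq> \<Omega>" using A by auto
  have y1: "0 \<le> matrix_pow \<Omega> K i x y" "matrix_pow \<Omega> K i x y \<le> 1" for i
    using transition_matrix_row_subset[OF M x y(2)] by auto
  show "0 \<le> exp (- t) * (t ^ i / fact i) * matrix_pow \<Omega> K i x y" for i
    using y1 t by simp
  show "((\<lambda>i. exp (- t) * (t ^ i / fact i) * matrix_pow \<Omega> K i x y) has_sum semigroup_matrix \<Omega> K t x y) UNIV"
    using has_sum_pois_avg[of "\<lambda>i. matrix_pow \<Omega> K i x y" t] y1 t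
    by (simp add: semigroup_matrix_def pois_avg_def)
qed

text \<open>The semigroup commutes with \<open>K\<close>; a shift of the time index by one is a step of the chain.\<close>

lemma pois_avg_visit_shift_has_sum:
  assumes K: "transition_matrix \<Omega> K" and t: "0 \<le> t" and A: "A \<subseteq> \<Omega>" and x: "x \<in> \<Omega>"
  shows "((\<lambda>z. K x z * pois_avg (\<lambda>i. visit \<Omega> K A z (i + j)) t) has_sum
    pois_avg (\<lambda>i. visit \<Omega> K A x (i + Suc j)) t) \<Omega>"
proof (rule has_sum_swap_nonneg[where I = "UNIV :: nat set"])
  note M = transition_matrix_pow[OF K]
  have v: "0 \<le> visit \<Omega> K A z i" "visit \<Omega> K A z i \<le> 1" if "z \<in> \<Omega>" for z i
    unfolding visit_def using transition_matrix_row_subset[OF M that A] by auto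
  let ?a = "\<lambda>i z. K x z * (exp (- t) * (t ^ i / fact i) * visit \<Omega> K A z (i + j))"
  show "((\<lambda>i. exp (- t) * (t ^ i / fact i) * visit \<Omega> K A x (i + Suc j)) has_sum
      pois_avg (\<lambda>i. visit \<Omega> K A x (i + Suc j)) t) UNIV"
    using v x t by (intro has_sum_pois_avg) auto
  show "(?a i has_sum exp (- t) * (t ^ i / fact i) * visit \<Omega> K A x (i + Suc j)) \<Omega>" for i
    using has_sum_cmult_right[OF visit_Suc_has_sum[OF K x A, of "i + j"], of "exp (- t) * (t ^ i / fact i)"]
    by (simp add: mult_ac)
  fix z assume z: "z \<in> \<Omega>"
  show "((\<lambda>i. ?a i z) has_sum K x z * pois_avg (\<lambda>i. visit \<Omega> K A z (i + j)) t) UNIV"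
    using v z t by (intro has_sum_cmult_right has_sum_pois_avg) auto
  show "0 \<le> ?a i z" for i
    using v[OF z] K x z t by (auto simp: transition_matrix_def)
qed

section \<open>Comparison of the distances to the stationary distribution\<close>

lemma SUP_tv_dist_le_iff:
  assumes "\<Omega> \<noteq> {}" and "prob_distribution \<Omega> \<pi>"
    and M: "\<And>x A. x \<in> \<Omega> \<Longrightarrow> A \<subseteq> \<Omega> \<Longrightarrow> infsum (M x) A \<le> 1"
  shows "(SUP x\<in>\<Omega>. tv_dist \<Omega> (M x) \<pi>) \<le> c \<longleftrightarrow>
    (\<forall>x\<in>\<Omega>. \<forall>A. A \<subseteq> \<Omega> \<longrightarrow> infsum (M x) A - infsum \<pi> A \<le> c)"
proof -
  have \<pi>0: "0 \<le> infsum \<pi> A" if "A \<subseteq> \<Omega>" for A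
    using assms(2) that by (auto simp: prob_distribution_def intro!: infsum_nonneg)
  have le: "infsum (M x) A - infsum \<pi> A \<le> 1" if "x \<in> \<Omega>" "A \<in> Pow \<Omega>" for x A
    using M[of x A] \<pi>0[of A] that by simp
  have tv: "tv_dist \<Omega> (M x) \<pi> \<le> c \<longleftrightarrow> (\<forall>A\<in>Pow \<Omega>. infsum (M x) A - infsum \<pi> A \<le> c)"
    if "x \<in> \<Omega>" for x c
    unfolding tv_dist_def by (rule cSUP_le_iff[OF _ bdd_aboveI2[OF le[OF that]]]) auto
  have "tv_dist \<Omega> (M x) \<pi> \<le> 1" if "x \<in> \<Omega>" for x
    unfolding tv[OF that] using le[OF that] by blast
  then have "(SUP x\<in>\<Omega>. tv_dist \<Omega> (M x) \<pi>) \<le> c \<longleftrightarrow> (\<forall>x\<in>\<Omega>. tv_dist \<Omega> (M x) \<pi> \<le> c)"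
    by (intro cSUP_le_iff assms(1) bdd_aboveI2)
  also have "\<dots> \<longleftrightarrow> (\<forall>x\<in>\<Omega>. \<forall>A. A \<subseteq> \<Omega> \<longrightarrow> infsum (M x) A - infsum \<pi> A \<le> c)"
    using tv by (metis PowD PowI)
  finally show ?thesis .
qed

locale chain_with_distribution =
  fixes \<Omega> :: "'a set" and K :: "'a \<Rightarrow> 'a \<Rightarrow> real" and \<pi> :: "'a \<Rightarrow> real"
  assumes K: "transition_matrix \<Omega> K" and \<pi>: "prob_distribution \<Omega> \<pi>"
begin

abbreviation "v \<equiv> visit \<Omega> K"

lemma nonempty: "\<Omega> \<noteq> {}"
  using \<pi> by (auto simp: prob_distribution_def dest: infsumI)

lemma pi_bounds:
  assumes "A \<subseteq> \<Omega>" shows "0 \<le> infsum \<pi> A" "infsum \<pi> A \<le> 1"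
    and pi_compl: "infsum \<pi> (\<Omega> - A) = 1 - infsum \<pi> A"
proof -
  have s: "\<pi> summable_on \<Omega>" "\<pi> summable_on A"
    using \<pi> assms summable_on_subset_banach[of \<pi> \<Omega> A] unfolding prob_distribution_def summable_on_def by blast+
  show c: "infsum \<pi> (\<Omega> - A) = 1 - infsum \<pi> A"
    using infsum_Diff[OF s assms] \<pi> by (simp add: prob_distribution_def infsumI)
  have "0 \<le> infsum \<pi> B" if "B \<subseteq> \<Omega>" for B
    using \<pi> that by (auto simp: prob_distribution_def intro!: infsum_nonneg)
  from this[OF assms] this[of "\<Omega> - A"] c show "0 \<le> infsum \<pi> A" "infsum \<pi> A \<le> 1" by auto
qed

lemma visit_bounds:
  assumes "x \<in> \<Omega>" "A \<subseteq> \<Omega>" shows "0 \<le> v A x i" "v A x i \<le> 1"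
  unfolding visit_def
  using transition_matrix_row_subset[OF transition_matrix_pow[OF K] assms] by auto

lemma visit_compl:
  assumes x: "x \<in> \<Omega>" and A: "A \<subseteq> \<Omega>" shows "v (\<Omega> - A) x i = 1 - v A x i"
proof -
  note M = transition_matrix_pow[OF K, of i]
  have "matrix_pow \<Omega> K i x summable_on A" "matrix_pow \<Omega> K i x summable_on \<Omega>"
    using transition_matrix_row_subset(1)[OF M x] A by (auto simp: summable_on_def)
  moreover have "infsum (matrix_pow \<Omega> K i x) \<Omega> = 1"
    using M x by (auto simp: transition_matrix_def infsumI)
  ultimately show ?thesis unfolding visit_def using A by (simp add: infsum_Diff)
qed

lemma visit_minus_abs_le:
  assumes "x \<in> \<Omega>" "A \<subseteq> \<Omega>" shows "\<bar>v A x i - infsum \<pi> A\<bar> \<le> 1"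
  using visit_bounds[OF assms, of i] pi_bounds[OF assms(2)] by auto

lemma pois_avg_visit_minus:
  assumes "x \<in> \<Omega>" "A \<subseteq> \<Omega>"
  shows "pois_avg (\<lambda>i. v A x i - c) t = pois_avg (v A x) t - c"
proof -
  have "\<bar>v A x i\<bar> \<le> 1" for i using visit_bounds[OF assms] by simp
  from pois_avg_diff[OF geom_growth_bounded[OF this] geom_growth_const] show ?thesis by simp
qed

lemma d_cont_le_iff:
  assumes "0 \<le> t"
  shows "d_cont \<Omega> K \<pi> t \<le> c \<longleftrightarrow> (\<forall>x\<in>\<Omega>. \<forall>A. A \<subseteq> \<Omega> \<longrightarrow> pois_avg (v A x) t - infsum \<pi> A \<le> c)"
proof -
  have "infsum (semigroup_matrix \<Omega> K t x) A \<le> 1" if "x \<in> \<Omega>" "A \<subseteq> \<Omega>" for x A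
    using visit_semigroup[OF K assms that(2,1)] abs_pois_avg_le[OF assms, of "v A x" 1] visit_bounds[OF that]
    by (auto simp: abs_le_iff)
  from SUP_tv_dist_le_iff[where M = "semigroup_matrix \<Omega> K t" and c = c, OF nonempty \<pi> this]
  show ?thesis unfolding d_cont_def using visit_semigroup[OF K assms] by simp
qed

lemma d_lazy_le_iff:
  assumes "0 < \<delta>" "\<delta> < 1"
  shows "d_lazy \<Omega> K \<pi> \<delta> m \<le> c \<longleftrightarrow>
    (\<forall>x\<in>\<Omega>. \<forall>A. A \<subseteq> \<Omega> \<longrightarrow> bin_avg (1 - \<delta>) m (v A x) - infsum \<pi> A \<le> c)"
proof -
  have \<delta>: "0 \<le> \<delta>" "\<delta> \<le> 1" using assms by auto
  note M = transition_matrix_pow[OF transition_matrix_lazy[OF K \<delta>], of m]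
  show ?thesis
    using SUP_tv_dist_le_iff[where M = "matrix_pow \<Omega> (lazy_matrix \<delta> K) m" and c = c,
        OF nonempty \<pi> transition_matrix_row_subset(3)[OF M]]
      visit_lazy[OF K \<delta>, of _ _ m] unfolding d_lazy_def by (simp add: visit_def)
qed

text \<open>The lower bound is the upper bound for the complement of \<open>A\<close>.\<close>

lemma d_cont_le_abs:
  assumes "0 \<le> t" "d_cont \<Omega> K \<pi> t \<le> c" and xA: "x \<in> \<Omega>" "A \<subseteq> \<Omega>"
  shows "\<bar>pois_avg (\<lambda>i. v A x i - infsum \<pi> A) t\<bar> \<le> c"
proof -
  have g: "geom_growth (v A x)" using visit_bounds[OF xA] by (intro geom_growth_bounded[of _ 1]) auto
  have eq: "v (\<Omega> - A) x = (\<lambda>i. 1 - v A x i)"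
    by (rule ext) (rule visit_compl[OF xA])
  have "pois_avg (v (\<Omega> - A) x) t = 1 - pois_avg (v A x) t"
    using pois_avg_diff[OF geom_growth_const g, of 1 t] by (simp add: eq)
  moreover have "pois_avg (v A x) t - infsum \<pi> A \<le> c" "pois_avg (v (\<Omega> - A) x) t - infsum \<pi> (\<Omega> - A) \<le> c"
    using assms(2) xA unfolding d_cont_le_iff[OF assms(1)] by blast+
  ultimately show ?thesis
    unfolding pois_avg_visit_minus[OF xA] pi_compl[OF xA(2)] by (simp add: abs_le_iff)
qed

text \<open>By induction on \<open>j\<close>, averaging over a first step shows that \<open>K\<^sup>j H\<^sub>t(x,A) - \<pi>(A)\<close> stays below
  the bound for \<open>H\<^sub>t\<close>; and \<open>H\<^sub>u\<close> is a mixture of the \<open>K\<^sup>j H\<^sub>t\<close>.\<close>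

lemma d_cont_mono:
  assumes t: "0 \<le> t" "t \<le> u" and le: "d_cont \<Omega> K \<pi> t \<le> c"
  shows "d_cont \<Omega> K \<pi> u \<le> c"
proof -
  have "pois_avg (v A x) u - infsum \<pi> A \<le> c" if x: "x \<in> \<Omega>" and A: "A \<subseteq> \<Omega>" for x A
  proof -
    define U where "U x j = pois_avg (\<lambda>i. v A x (i + j)) t" for x j
    have U: "U x j \<le> infsum \<pi> A + c" if "x \<in> \<Omega>" for x j
      using that
    proof (induction j arbitrary: x)
      case 0
      then have "pois_avg (v A x) t - infsum \<pi> A \<le> c"
        using le A unfolding d_cont_le_iff[OF t(1)] by blast
      then show ?case by (simp add: U_def)
    next
      case (Suc j)
      have "((\<lambda>z. K x z * U z j) has_sum U x (Suc j)) \<Omega>"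
        unfolding U_def by (rule pois_avg_visit_shift_has_sum[OF K t(1) A Suc.prems])
      moreover have "((\<lambda>z. K x z * (infsum \<pi> A + c)) has_sum 1 * (infsum \<pi> A + c)) \<Omega>"
        using K Suc.prems by (intro has_sum_cmult_left) (simp add: transition_matrix_def)
      moreover have "K x z * U z j \<le> K x z * (infsum \<pi> A + c)" if "z \<in> \<Omega>" for z
        using K Suc.prems that by (intro mult_left_mono Suc.IH) (auto simp: transition_matrix_def)
      ultimately have "U x (Suc j) \<le> 1 * (infsum \<pi> A + c)"
        by (rule has_sum_mono)
      then show ?case by simp
    qed
    have v1: "\<bar>v A x i\<bar> \<le> 1" for i using visit_bounds[OF x A] by simp
    have U1: "\<bar>U x j\<bar> \<le> 1" for j
      unfolding U_def by (rule abs_pois_avg_le[OF t(1)]) (rule v1)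
    have "pois_avg (v A x) (t + (u - t)) = pois_avg (U x) (u - t)"
      unfolding U_def[abs_def] by (rule pois_avg_semigroup[OF v1 t(1)])
    also have "\<dots> \<le> pois_avg (\<lambda>j. infsum \<pi> A + c) (u - t)"
      by (rule pois_avg_mono[OF geom_growth_bounded[OF U1] geom_growth_const _ U[OF x]]) (use t in simp)
    finally show ?thesis by simp
  qed
  then show ?thesis using t by (subst d_cont_le_iff) auto
qed

text \<open>The derivative of a Poisson average of probabilities is an average of differences of probabilities.\<close>

lemma d_cont_Lipschitz:
  assumes h: "0 \<le> h" "h \<le> t" and le: "d_cont \<Omega> K \<pi> t \<le> c"
  shows "d_cont \<Omega> K \<pi> (t - h) \<le> c + h"
proof -
  have "pois_avg (v A x) (t - h) - infsum \<pi> A \<le> c + h" if x: "x \<in> \<Omega>" and A: "A \<subseteq> \<Omega>" for x A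
  proof -
    have g: "geom_growth (v A x)" using visit_bounds[OF x A] by (intro geom_growth_bounded[of _ 1]) auto
    have d: "\<bar>fdiff (v A x) i\<bar> \<le> 1" for i
      using visit_bounds[OF x A, of i] visit_bounds[OF x A, of "Suc i"] by (auto simp: fdiff_def)
    have "norm (pois_avg (v A x) t - pois_avg (v A x) (t - h)) \<le> 1 * norm (t - (t - h))"
    proof (rule field_differentiable_bound[where S = "{0..}"])
      show "(pois_avg (v A x) has_field_derivative pois_avg (fdiff (v A x)) s) (at s within {0..})" for s
        by (rule has_field_derivative_at_within[OF has_field_derivative_pois_avg[OF g]])
      show "norm (pois_avg (fdiff (v A x)) s) \<le> 1" if "s \<in> {0..}" for s
        using abs_pois_avg_le[OF _ d, of s] that by simp
    qed (use h in auto)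
    moreover have "pois_avg (v A x) t - infsum \<pi> A \<le> c"
      using le h x A by (auto simp: d_cont_le_iff)
    ultimately show ?thesis using h by (auto simp: abs_le_iff)
  qed
  then show ?thesis using h by (subst d_cont_le_iff) auto
qed

text \<open>The lazy walk moves with probability \<open>1 - \<delta>\<close> only.\<close>

lemma d_lazy_Suc_le:
  assumes \<delta>: "0 < \<delta>" "\<delta> < 1" and le: "d_lazy \<Omega> K \<pi> \<delta> (Suc m) \<le> c"
  shows "d_lazy \<Omega> K \<pi> \<delta> m \<le> c + (1 - \<delta>)"
proof -
  have "bin_avg (1 - \<delta>) m (v A x) - infsum \<pi> A \<le> c + (1 - \<delta>)" if x: "x \<in> \<Omega>" and A: "A \<subseteq> \<Omega>" for x A
  proof -
    have d: "\<bar>fdiff (v A x) i\<bar> \<le> 1" for i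
      using visit_bounds[OF x A, of i] visit_bounds[OF x A, of "Suc i"] by (auto simp: fdiff_def)
    have "\<bar>bin_avg (1 - \<delta>) m (fdiff (v A x))\<bar> \<le> 1"
      using \<delta> by (intro abs_bin_avg_le d) auto
    then have "(1 - \<delta>) * \<bar>bin_avg (1 - \<delta>) m (fdiff (v A x))\<bar> \<le> (1 - \<delta>) * 1"
      using \<delta> by (intro mult_left_mono) auto
    then have "\<bar>(1 - \<delta>) * bin_avg (1 - \<delta>) m (fdiff (v A x))\<bar> \<le> 1 - \<delta>"
      using \<delta> by (simp add: abs_mult)
    moreover have "bin_avg (1 - \<delta>) (Suc m) (v A x) - infsum \<pi> A \<le> c"
      using le x A unfolding d_lazy_le_iff[OF \<delta>] by blast
    ultimately show ?thesis unfolding bin_avg_Suc_fdiff by linarith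
  qed
  then show ?thesis unfolding d_lazy_le_iff[OF \<delta>] by blast
qed

text \<open>The \<open>L\<^sup>2\<close> norm of a sequence of probabilities is at most \<open>1\<close>.\<close>

lemma bin_avg_visit_close:
  assumes \<delta>: "0 < \<delta>" "\<delta> < 1" and x: "x \<in> \<Omega>" and A: "A \<subseteq> \<Omega>"
  shows "\<bar>bin_avg (1 - \<delta>) m (v A x) - pois_avg (v A x) ((1 - \<delta>) * real m)\<bar>
    \<le> exp 1 * sqrt (1 - \<delta>) / (1 - sqrt (1 - \<delta>))\<^sup>2"
proof -
  have v: "\<bar>v A x i\<bar> \<le> 1" for i using visit_bounds[OF x A] by simp
  have "pois_avg (\<lambda>i. (v A x i)\<^sup>2) ((1 - \<delta>) * real m) \<le> 1"
    using abs_pois_avg_le[of "(1 - \<delta>) * real m" "\<lambda>i. (v A x i)\<^sup>2" 1] v \<delta> by (simp add: abs_square_le_1)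
  then have "exp 1 * sqrt (1 - \<delta>) / (1 - sqrt (1 - \<delta>))\<^sup>2 * sqrt (pois_avg (\<lambda>i. (v A x i)\<^sup>2) ((1 - \<delta>) * real m))
    \<le> exp 1 * sqrt (1 - \<delta>) / (1 - sqrt (1 - \<delta>))\<^sup>2 * 1"
    using \<delta> by (intro mult_left_mono) auto
  then show ?thesis using bin_avg_close_pois_avg[of "1 - \<delta>" "v A x" 1 m] v \<delta> by simp
qed

lemma d_cont_le_d_lazy:
  assumes \<delta>: "0 < \<delta>" "\<delta> < 1" and le: "d_lazy \<Omega> K \<pi> \<delta> m \<le> c"
  shows "d_cont \<Omega> K \<pi> ((1 - \<delta>) * real m) \<le> c + exp 1 * sqrt (1 - \<delta>) / (1 - sqrt (1 - \<delta>))\<^sup>2"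
proof -
  have t: "0 \<le> (1 - \<delta>) * real m" using \<delta> by simp
  have "bin_avg (1 - \<delta>) m (v A x) - infsum \<pi> A \<le> c" if "x \<in> \<Omega>" "A \<subseteq> \<Omega>" for x A
    using le that unfolding d_lazy_le_iff[OF \<delta>] by blast
  then show ?thesis
    unfolding d_cont_le_iff[OF t] using bin_avg_visit_close[OF \<delta>, of _ _ m] by (smt (verit))
qed

lemma d_lazy_le_d_cont:
  assumes \<delta>: "0 < \<delta>" "\<delta> < 1" and le: "d_cont \<Omega> K \<pi> ((1 - \<delta>) * real m) \<le> c"
  shows "d_lazy \<Omega> K \<pi> \<delta> m \<le> c + exp 1 * sqrt (1 - \<delta>) / (1 - sqrt (1 - \<delta>))\<^sup>2"
proof -
  have "pois_avg (v A x) ((1 - \<delta>) * real m) - infsum \<pi> A \<le> c" if "x \<in> \<Omega>" "A \<subseteq> \<Omega>" for x A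
    using le \<delta> that by (subst (asm) d_cont_le_iff) auto
  then show ?thesis
    using bin_avg_visit_close[OF \<delta>, of _ _ m] unfolding d_lazy_le_iff[OF \<delta>] by (smt (verit))
qed

end

text \<open>Since the distance of the semigroup decreases, all later Poisson averages of \<open>K\<^sup>i(x,A) - \<pi>(A)\<close> are small as well.
  The constant \<open>\<eta>\<close> must be uniform over all chains, because it is used for a whole family.\<close>

lemma d_lazy_small_if_d_cont_small:
  assumes \<delta>: "0 < \<delta>" "\<delta> < 1" and \<epsilon>: "0 < \<epsilon>"
  shows "\<exists>\<eta>>0. \<forall>(\<Omega> :: 'a set) K \<pi> m. chain_with_distribution \<Omega> K \<pi> \<longrightarrow> d_cont \<Omega> K \<pi> ((1 - \<delta>) * real m) \<le> \<eta> \<longrightarrow>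
    d_lazy \<Omega> K \<pi> \<delta> m \<le> \<epsilon>"
proof -
  obtain \<eta> where \<eta>: "\<eta> > 0" and small: "\<And>m f. (\<forall>i. \<bar>f i\<bar> \<le> 1) \<Longrightarrow>
     (\<forall>s\<ge>(1 - \<delta>) * real m. \<bar>pois_avg f s\<bar> \<le> \<eta>) \<Longrightarrow> \<bar>bin_avg (1 - \<delta>) m f\<bar> \<le> \<epsilon>"
    using bin_avg_small[of "1 - \<delta>" \<epsilon>] \<delta> \<epsilon> by auto
  show ?thesis
  proof (intro exI[of _ \<eta>] conjI allI impI \<eta>)
    fix \<Omega> :: "'a set" and K \<pi> m
    assume "chain_with_distribution \<Omega> K \<pi>" and le: "d_cont \<Omega> K \<pi> ((1 - \<delta>) * real m) \<le> \<eta>"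
    interpret chain_with_distribution \<Omega> K \<pi> by fact
    let ?t = "(1 - \<delta>) * real m"
    have t: "0 \<le> ?t" using \<delta> by simp
    have "bin_avg (1 - \<delta>) m (v A x) - infsum \<pi> A \<le> \<epsilon>" if xA: "x \<in> \<Omega>" "A \<subseteq> \<Omega>" for x A
    proof -
      have "\<bar>bin_avg (1 - \<delta>) m (\<lambda>i. v A x i - infsum \<pi> A)\<bar> \<le> \<epsilon>"
      proof (rule small)
        show "\<forall>s\<ge>?t. \<bar>pois_avg (\<lambda>i. v A x i - infsum \<pi> A) s\<bar> \<le> \<eta>"
          using d_cont_le_abs[OF _ d_cont_mono[OF t _ le] xA] t by auto
      qed (use visit_minus_abs_le[OF xA] in auto)
      then show ?thesis by (simp add: bin_avg_diff)
    qed
    then show "d_lazy \<Omega> K \<pi> \<delta> m \<le> \<epsilon>" unfolding d_lazy_le_iff[OF \<delta>] by blast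
  qed
qed

text \<open>If the semigroup at time \<open>(1 - \<delta>) m\<close> is at distance more than \<open>1 - \<kappa>\<close> from \<open>\<pi>\<close>, there is a set \<open>A\<close> with
  \<open>\<pi>(A) < \<kappa>\<close> whose complement has probability less than \<open>\<kappa>\<close> under the semigroup. The Cauchy-Schwarz bound makes the
  probability of the complement under the lazy walk at most \<open>C sqrt \<kappa>\<close>, so the lazy walk too is almost at
  distance \<open>1\<close>.\<close>

lemma d_cont_not_near_one_if_d_lazy:
  assumes \<delta>: "0 < \<delta>" "\<delta> < 1" and \<epsilon>: "\<epsilon> < 1"
  shows "\<exists>\<kappa>. 0 < \<kappa> \<and> \<kappa> < 1 \<and> (\<forall>(\<Omega> :: 'a set) K \<pi> m. chain_with_distribution \<Omega> K \<pi> \<longrightarrow> d_lazy \<Omega> K \<pi> \<delta> m \<le> \<epsilon> \<longrightarrow>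
    d_cont \<Omega> K \<pi> ((1 - \<delta>) * real m) \<le> 1 - \<kappa>)"
proof -
  define C where "C = 1 + exp 1 * sqrt (1 - \<delta>) / (1 - sqrt (1 - \<delta>))\<^sup>2"
  have C: "1 \<le> C" using \<delta> by (simp add: C_def)
  \<comment> \<open>With \<open>\<kappa> = r\<^sup>2 \<le> r\<close> the total loss \<open>C sqrt \<kappa> + \<kappa>\<close> is at most \<open>(C + 1) r\<close>.\<close>
  define r where "r = min (1 / 2) ((1 - \<epsilon>) / (2 * (C + 1)))"
  have r: "0 < r" "r \<le> 1 / 2" "r \<le> (1 - \<epsilon>) / (2 * (C + 1))"
    using \<epsilon> C by (simp add: r_def) (simp_all only: r_def min.cobounded1 min.cobounded2)
  define \<kappa> where "\<kappa> = r\<^sup>2"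
  have "r * r \<le> r * 1" using r by (intro mult_left_mono) auto
  then have "\<kappa> \<le> r" by (simp add: \<kappa>_def power2_eq_square)
  then have \<kappa>: "0 < \<kappa>" "\<kappa> \<le> r" "\<kappa> < 1" "sqrt \<kappa> = r" using r by (auto simp: \<kappa>_def)
  have "(C + 1) * r \<le> (1 - \<epsilon>) / 2"
    using r(3) C by (simp add: field_simps)
  then have \<kappa>C: "C * sqrt \<kappa> + \<kappa> < 1 - \<epsilon>"
    using \<kappa> \<epsilon> by (simp add: algebra_simps)
  show ?thesis
  proof (intro exI[of _ \<kappa>] conjI allI impI \<kappa>)
    fix \<Omega> :: "'a set" and K \<pi> m
    assume "chain_with_distribution \<Omega> K \<pi>" and le: "d_lazy \<Omega> K \<pi> \<delta> m \<le> \<epsilon>"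
    interpret chain_with_distribution \<Omega> K \<pi> by fact
    let ?t = "(1 - \<delta>) * real m"
    have t: "0 \<le> ?t" using \<delta> by simp
    have "pois_avg (v A x) ?t - infsum \<pi> A \<le> 1 - \<kappa>" if xA: "x \<in> \<Omega>" "A \<subseteq> \<Omega>" for x A
    proof (rule ccontr)
      assume "\<not> ?thesis"
      then have big: "pois_avg (v A x) ?t - infsum \<pi> A > 1 - \<kappa>" by simp
      let ?g = "\<lambda>i. 1 - v A x i"
      have g: "0 \<le> ?g i" "?g i \<le> 1" for i using visit_bounds[OF xA, of i] by auto
      have gg: "geom_growth ?g" "geom_growth (\<lambda>i. (?g i)\<^sup>2)" "geom_growth (v A x)"
        using g visit_bounds[OF xA] by (auto intro!: geom_growth_bounded[of _ 1] simp: abs_square_le_1 abs_le_iff)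
      have P: "pois_avg ?g ?t = 1 - pois_avg (v A x) ?t"
        using pois_avg_diff[OF geom_growth_const gg(3), of 1 ?t] by simp
      have "0 \<le> pois_avg ?g ?t" by (rule pois_avg_nonneg[OF gg(1) t g(1)])
      then have \<pi>A: "infsum \<pi> A < \<kappa>" using big P by simp
      have gk: "pois_avg ?g ?t < \<kappa>" using big P pi_bounds[OF xA(2)] by simp
      have "pois_avg (\<lambda>i. (?g i)\<^sup>2) ?t \<le> pois_avg ?g ?t"
        using g by (intro pois_avg_mono gg t) (simp add: power2_eq_square mult_left_le)
      then have sq: "sqrt (pois_avg (\<lambda>i. (?g i)\<^sup>2) ?t) \<le> sqrt \<kappa>" using gk by simp
      have "bin_avg (1 - \<delta>) m ?g \<le> pois_avg ?g ?t + (C - 1) * sqrt (pois_avg (\<lambda>i. (?g i)\<^sup>2) ?t)"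
      proof -
        have "\<bar>?g i\<bar> \<le> 1" for i using g[of i] by simp
        then have "\<bar>bin_avg (1 - \<delta>) m ?g - pois_avg ?g ?t\<bar> \<le> (C - 1) * sqrt (pois_avg (\<lambda>i. (?g i)\<^sup>2) ?t)"
          using \<delta> bin_avg_close_pois_avg[of "1 - \<delta>" ?g 1 m] by (simp add: C_def)
        then show ?thesis by linarith
      qed
      also have "\<dots> \<le> sqrt \<kappa> + (C - 1) * sqrt \<kappa>"
        using gk \<kappa> C sq by (intro add_mono mult_left_mono) auto
      finally have "bin_avg (1 - \<delta>) m ?g \<le> C * sqrt \<kappa>" by (simp add: algebra_simps)
      then have "1 - C * sqrt \<kappa> \<le> bin_avg (1 - \<delta>) m (v A x)" by (simp add: bin_avg_diff)
      moreover have "bin_avg (1 - \<delta>) m (v A x) - infsum \<pi> A \<le> \<epsilon>"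
        using le xA unfolding d_lazy_le_iff[OF \<delta>] by blast
      ultimately show False using \<pi>A \<kappa>C by linarith
    qed
    then show "d_cont \<Omega> K \<pi> ?t \<le> 1 - \<kappa>" using t by (subst d_cont_le_iff) auto
  qed
qed

section \<open>Cutoff windows\<close>

text \<open>A mixing time is the infimum of a set \<open>S n\<close> of times. Being within \<open>O(b n)\<close> of \<open>t n\<close> means that this set reaches
  down to \<open>t n\<close> and not further, up to multiples of \<open>b n\<close>. In this form there is no infinite value to exclude,
  and the two halves can be transferred separately.\<close>

definition lower_window :: "(nat \<Rightarrow> real set) \<Rightarrow> (nat \<Rightarrow> real) \<Rightarrow> (nat \<Rightarrow> real) \<Rightarrow> bool" where
  "lower_window S t b \<longleftrightarrow> (\<exists>C. \<forall>\<^sub>F n in sequentially. \<forall>s\<in>S n. t n - C * b n \<le> s)"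

definition upper_window :: "(nat \<Rightarrow> real set) \<Rightarrow> (nat \<Rightarrow> real) \<Rightarrow> (nat \<Rightarrow> real) \<Rightarrow> bool" where
  "upper_window S t b \<longleftrightarrow> (\<exists>C. \<forall>\<^sub>F n in sequentially. \<exists>s\<in>S n. s \<le> t n + C * b n)"

lemma abs_ereal_minus_le_iff:
  "\<bar>x - ereal t\<bar> \<le> ereal r \<longleftrightarrow> ereal (t - r) \<le> x \<and> x \<le> ereal (t + r)"
  by (cases x) auto

text \<open>An infimum at most \<open>t n + C b n\<close> need not be attained; the constant \<open>C + 1\<close> makes room for an element of the set.\<close>

lemma has_cutoff_iff_windows:
  assumes T: "\<And>n \<epsilon>. T n \<epsilon> = (INF s\<in>S \<epsilon> n. ereal s)" and b: "\<And>n. n \<ge> 1 \<Longrightarrow> 0 < b n"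
  shows "has_cutoff T t b \<longleftrightarrow>
    b \<in> o(t) \<and> (\<forall>\<epsilon>\<in>{0<..<1}. lower_window (S \<epsilon>) t b \<and> upper_window (S \<epsilon>) t b)"
proof -
  have "(\<exists>C>0. \<exists>N>0. \<forall>n\<ge>N. \<bar>T n \<epsilon> - ereal (t n)\<bar> \<le> ereal (C * \<bar>b n\<bar>))
      \<longleftrightarrow> lower_window (S \<epsilon>) t b \<and> upper_window (S \<epsilon>) t b" (is "?L \<longleftrightarrow> ?R") for \<epsilon>
  proof
    assume ?L
    then obtain C N where N: "N > 0" and C: "\<And>n. n \<ge> N \<Longrightarrow> \<bar>T n \<epsilon> - ereal (t n)\<bar> \<le> ereal (C * \<bar>b n\<bar>)"
      by blast
    have "\<forall>s\<in>S \<epsilon> n. t n - C * b n \<le> s" "\<exists>s\<in>S \<epsilon> n. s \<le> t n + (C + 1) * b n" if n: "n \<ge> N" for n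
    proof -
      have bn: "0 < b n" using b n N by simp
      have le: "ereal (t n - C * b n) \<le> T n \<epsilon>" "T n \<epsilon> \<le> ereal (t n + C * b n)"
        using C[OF n] bn by (simp_all add: abs_ereal_minus_le_iff)
      show "\<forall>s\<in>S \<epsilon> n. t n - C * b n \<le> s"
        using le(1) unfolding T le_INF_iff by simp
      have "T n \<epsilon> < ereal (t n + (C + 1) * b n)"
        using le(2) bn by (elim le_less_trans) (simp add: algebra_simps)
      then obtain s where "s \<in> S \<epsilon> n" "ereal s < ereal (t n + (C + 1) * b n)"
        unfolding T INF_less_iff by blast
      then show "\<exists>s\<in>S \<epsilon> n. s \<le> t n + (C + 1) * b n" by (intro bexI[of _ s]) auto
    qed
    then show ?R unfolding lower_window_def upper_window_def eventually_sequentially by blast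
  next
    assume ?R
    then obtain C1 C2 where "\<forall>\<^sub>F n in sequentially. \<forall>s\<in>S \<epsilon> n. t n - C1 * b n \<le> s"
        "\<forall>\<^sub>F n in sequentially. \<exists>s\<in>S \<epsilon> n. s \<le> t n + C2 * b n"
      unfolding lower_window_def upper_window_def by blast
    then have "\<forall>\<^sub>F n in sequentially. n \<ge> 1 \<and> (\<forall>s\<in>S \<epsilon> n. t n - C1 * b n \<le> s) \<and> (\<exists>s\<in>S \<epsilon> n. s \<le> t n + C2 * b n)"
      using eventually_ge_at_top[of 1] by eventually_elim auto
    then obtain N where N: "\<And>n. n \<ge> N \<Longrightarrow> n \<ge> 1 \<and> (\<forall>s\<in>S \<epsilon> n. t n - C1 * b n \<le> s) \<and> (\<exists>s\<in>S \<epsilon> n. s \<le> t n + C2 * b n)"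
      unfolding eventually_sequentially by blast
    define C where "C = max 1 (max C1 C2)"
    have C: "1 \<le> C" "C1 \<le> C" "C2 \<le> C" by (auto simp: C_def)
    have "\<bar>T n \<epsilon> - ereal (t n)\<bar> \<le> ereal (C * \<bar>b n\<bar>)" if Sn: "n \<ge> Suc N" for n
    proof -
      have n: "n \<ge> 1" "\<forall>s\<in>S \<epsilon> n. t n - C1 * b n \<le> s" using N[of n] Sn by auto
      obtain s where s: "s \<in> S \<epsilon> n" "s \<le> t n + C2 * b n"
        using N[OF Suc_leD[OF Sn]] by blast
      have bn: "0 < b n" using b n(1) by simp
      have Cb: "C1 * b n \<le> C * b n" "C2 * b n \<le> C * b n" using C bn by (auto intro: mult_right_mono)
      have "ereal (t n - C * b n) \<le> T n \<epsilon>"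
        unfolding T using n(2) Cb by (intro INF_greatest) force
      moreover have "T n \<epsilon> \<le> ereal (t n + C * b n)"
        unfolding T using s Cb by (intro INF_lower2[OF s(1)]) auto
      ultimately show ?thesis using bn by (simp add: abs_ereal_minus_le_iff)
    qed
    moreover have "0 < C" using C by simp
    ultimately show ?L by blast
  qed
  then show ?thesis unfolding has_cutoff_def by simp
qed

text \<open>The times in \<open>S n\<close> tend to infinity with \<open>n\<close>, hence a step of length \<open>h\<close> back is possible and leads to
  \<open>S' n\<close>. Both sets start within \<open>O(b n)\<close> of \<open>t n\<close>, so \<open>h = O(b n)\<close>.\<close>

lemma window_bounded_below:
  assumes o: "b \<in> o(t)" and t: "filterlim t at_top sequentially" and b: "\<And>n. n \<ge> 1 \<Longrightarrow> 0 < b n"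
    and low: "lower_window S t b" and up: "upper_window S t b" and low': "lower_window S' t b" and h: "0 < h"
    and step: "\<And>n s. n \<ge> 1 \<Longrightarrow> s \<in> S n \<Longrightarrow> h \<le> s \<Longrightarrow> s - h \<in> S' n"
  shows "\<exists>c>0. \<forall>\<^sub>F n in sequentially. c \<le> b n"
proof -
  obtain C where C: "\<forall>\<^sub>F n in sequentially. \<forall>s\<in>S n. t n - C * b n \<le> s"
    using low unfolding lower_window_def by blast
  obtain C1 where C1: "\<forall>\<^sub>F n in sequentially. \<exists>s\<in>S n. s \<le> t n + C1 * b n"
    using up unfolding upper_window_def by blast
  obtain C2 where C2: "\<forall>\<^sub>F n in sequentially. \<forall>s\<in>S' n. t n - C2 * b n \<le> s"
    using low' unfolding lower_window_def by blast
  define D where "D = \<bar>C\<bar> + 1"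
  have D: "0 < D" "C \<le> D" by (auto simp: D_def)
  have ob: "\<forall>\<^sub>F n in sequentially. norm (b n) \<le> 1 / (2 * D) * norm (t n)"
    using landau_o.smallD[OF o, of "1 / (2 * D)"] D by simp
  have tl: "\<forall>\<^sub>F n in sequentially. 2 * h \<le> t n"
    using t by (simp add: filterlim_at_top)
  define c where "c = h / (\<bar>C1 + C2\<bar> + 1)"
  have c: "0 < c" using h by (simp add: c_def add_nonneg_pos)
  have "\<forall>\<^sub>F n in sequentially. c \<le> b n"
    using C C1 C2 ob tl eventually_ge_at_top[of 1]
  proof eventually_elim
    case (elim n)
    then have bn: "0 < b n" using b by simp
    obtain s where s: "s \<in> S n" "s \<le> t n + C1 * b n" using elim by blast
    have "D * b n \<le> t n / 2"
      using elim(4) D bn elim(5) h by (simp add: field_simps)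
    moreover have "C * b n \<le> D * b n" using D bn by (intro mult_right_mono) auto
    ultimately have "h \<le> s" using elim(1,5) s by force
    then have "t n - C2 * b n \<le> s - h" using step[OF elim(6) s(1)] elim(3) by blast
    then have "h \<le> (C1 + C2) * b n" using s(2) by (simp add: algebra_simps)
    also have "\<dots> \<le> (\<bar>C1 + C2\<bar> + 1) * b n" using bn by (intro mult_right_mono) auto
    finally show "c \<le> b n" by (simp add: c_def pos_divide_le_eq add_nonneg_pos mult.commute)
  qed
  with c show ?thesis by blast
qed

text \<open>The additive error \<open>d\<close> is absorbed into the window, which is where the lower bound on \<open>b\<close> is used.\<close>

lemma lower_window_transfer:
  assumes low: "lower_window S t b" and c: "0 < c" "\<forall>\<^sub>F n in sequentially. c \<le> b n" and a: "0 < a" and d: "0 \<le> d"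
    and step: "\<And>n s'. n \<ge> 1 \<Longrightarrow> s' \<in> S' n \<Longrightarrow> \<exists>s\<in>S n. s \<le> a * s' + d"
  shows "lower_window S' (\<lambda>n. t n / a) b"
proof -
  obtain C where C: "\<forall>\<^sub>F n in sequentially. \<forall>s\<in>S n. t n - C * b n \<le> s"
    using low unfolding lower_window_def by blast
  have "\<forall>\<^sub>F n in sequentially. \<forall>s'\<in>S' n. t n / a - (C + d / c) / a * b n \<le> s'"
    using C c(2) eventually_ge_at_top[of 1]
  proof eventually_elim
    case (elim n)
    show ?case
    proof
      fix s' assume "s' \<in> S' n"
      then obtain s where s: "s \<in> S n" "s \<le> a * s' + d" using step elim by blast
      have "d / c * c \<le> d / c * b n" using elim d c by (intro mult_left_mono) auto
      then have "d \<le> d / c * b n" using c by simp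
      then have "t n - (C + d / c) * b n \<le> s - d"
        using elim(1) s(1) by (fastforce simp: distrib_right)
      also have "\<dots> \<le> a * s'" using s by simp
      finally show "t n / a - (C + d / c) / a * b n \<le> s'"
        using a by (simp add: field_simps)
    qed
  qed
  then show ?thesis unfolding lower_window_def by blast
qed

lemma upper_window_transfer:
  assumes up: "upper_window S t b" and c: "0 < c" "\<forall>\<^sub>F n in sequentially. c \<le> b n" and a: "0 < a" and d: "0 \<le> d"
    and step: "\<And>n s. n \<ge> 1 \<Longrightarrow> s \<in> S n \<Longrightarrow> \<exists>s'\<in>S' n. s' \<le> a * s + d"
  shows "upper_window S' (\<lambda>n. a * t n) b"
proof -
  obtain C where C: "\<forall>\<^sub>F n in sequentially. \<exists>s\<in>S n. s \<le> t n + C * b n"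
    using up unfolding upper_window_def by blast
  have "\<forall>\<^sub>F n in sequentially. \<exists>s'\<in>S' n. s' \<le> a * t n + (a * C + d / c) * b n"
    using C c(2) eventually_ge_at_top[of 1]
  proof eventually_elim
    case (elim n)
    obtain s where s: "s \<in> S n" "s \<le> t n + C * b n" using elim by blast
    obtain s' where s': "s' \<in> S' n" "s' \<le> a * s + d" using step[OF elim(3) s(1)] by blast
    have "d / c * c \<le> d / c * b n" using elim d c by (intro mult_left_mono) auto
    then have "d \<le> d / c * b n" using c by simp
    moreover have "a * s \<le> a * (t n + C * b n)" using s a by (intro mult_left_mono) auto
    ultimately have "s' \<le> a * t n + (a * C + d / c) * b n"
      using s' by (simp add: algebra_simps)
    with s' show ?case by blast
  qed
  then show ?thesis unfolding upper_window_def by blast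
qed

definition cont_times :: "'a set \<Rightarrow> ('a \<Rightarrow> 'a \<Rightarrow> real) \<Rightarrow> ('a \<Rightarrow> real) \<Rightarrow> real \<Rightarrow> real set" where
  "cont_times \<Omega> K \<pi> \<epsilon> = {t. 0 \<le> t \<and> d_cont \<Omega> K \<pi> t \<le> \<epsilon>}"

definition lazy_times :: "'a set \<Rightarrow> ('a \<Rightarrow> 'a \<Rightarrow> real) \<Rightarrow> ('a \<Rightarrow> real) \<Rightarrow> real \<Rightarrow> real \<Rightarrow> real set" where
  "lazy_times \<Omega> K \<pi> \<delta> \<epsilon> = real ` {m. d_lazy \<Omega> K \<pi> \<delta> m \<le> \<epsilon>}"

text \<open>Choose \<open>\<delta> = 1 - s\<^sup>2\<close> with \<open>s\<close> so small that \<open>4 s exp 1\<close> is at most the given error and \<open>s \<le> 1/2\<close>.\<close>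

lemma lazy_error_small:
  assumes "0 < (e :: real)"
  shows "\<exists>\<delta>. 0 < \<delta> \<and> \<delta> < 1 \<and> exp 1 * sqrt (1 - \<delta>) / (1 - sqrt (1 - \<delta>))\<^sup>2 \<le> e"
proof -
  define s where "s = min (1 / 2) (e / (4 * exp 1))"
  have s: "0 < s" "s \<le> 1 / 2" "s \<le> e / (4 * exp 1)"
    using assms by (simp add: s_def) (simp_all only: s_def min.cobounded1 min.cobounded2)
  have s2: "0 < s\<^sup>2" "s\<^sup>2 < 1"
    using s by (simp_all add: power_less_one_iff abs_square_less_1)
  have "(1 / 2)\<^sup>2 \<le> (1 - s)\<^sup>2" using s by (intro power_mono) auto
  then have "exp 1 * s / (1 - s)\<^sup>2 \<le> exp 1 * s / (1 / 2)\<^sup>2"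
    using s by (intro divide_left_mono) auto
  also have "\<dots> \<le> e" using s(3) by (simp add: field_simps power2_eq_square)
  finally have "exp 1 * sqrt (1 - (1 - s\<^sup>2)) / (1 - sqrt (1 - (1 - s\<^sup>2)))\<^sup>2 \<le> e"
    using s by simp
  with s2 show ?thesis by (intro exI[of _ "1 - s\<^sup>2"]) auto
qed

lemma nat_ceiling_divide_bounds:
  assumes "0 < p" "0 \<le> s"
  shows "s \<le> p * real (nat \<lceil>s / p\<rceil>)" "real (nat \<lceil>s / p\<rceil>) \<le> 1 / p * s + 1"
proof -
  have "s / p \<le> real (nat \<lceil>s / p\<rceil>)" by (rule real_nat_ceiling_ge)
  then show "s \<le> p * real (nat \<lceil>s / p\<rceil>)"
    by (simp only: pos_divide_le_eq[OF assms(1)] mult.commute)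
  have "0 \<le> s / p" using assms by simp
  then show "real (nat \<lceil>s / p\<rceil>) \<le> 1 / p * s + 1" by (simp add: of_nat_nat)
qed

theorem theorem1p2:
  fixes \<Omega> :: "nat \<Rightarrow> 'a set"
    and K :: "nat \<Rightarrow> 'a \<Rightarrow> 'a \<Rightarrow> real"
    and \<pi> :: "nat \<Rightarrow> 'a \<Rightarrow> real"
    and t b :: "nat \<Rightarrow> real"
  assumes "\<And>n. n \<ge> 1 \<Longrightarrow> countable (\<Omega> n)"
    and "\<And>n. n \<ge> 1 \<Longrightarrow> transition_matrix (\<Omega> n) (K n)"
    and "\<And>n. n \<ge> 1 \<Longrightarrow> stationary_distribution (\<Omega> n) (K n) (\<pi> n)"
    and "\<And>n. n \<ge> 1 \<Longrightarrow> irreducible_chain (\<Omega> n) (K n)"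
    and "\<And>n. n \<ge> 1 \<Longrightarrow> positive_recurrent (\<Omega> n) (K n)"
    and "\<And>n. n \<ge> 1 \<Longrightarrow> t n > 0"
    and "\<And>n. n \<ge> 1 \<Longrightarrow> b n > 0"
    and "filterlim t at_top sequentially"
  shows "has_cutoff (\<lambda>n \<epsilon>. T_cont (\<Omega> n) (K n) (\<pi> n) \<epsilon>) t b \<longleftrightarrow>
    (\<forall>\<delta>\<in>{0<..<1}.
      has_cutoff (\<lambda>n \<epsilon>. T_lazy (\<Omega> n) (K n) (\<pi> n) \<delta> \<epsilon>) (\<lambda>n. t n / (1 - \<delta>)) b)"
proof -
  let ?S = "\<lambda>\<epsilon> n. cont_times (\<Omega> n) (K n) (\<pi> n) \<epsilon>"
  let ?L = "\<lambda>\<delta> \<epsilon> n. lazy_times (\<Omega> n) (K n) (\<pi> n) \<delta> \<epsilon>"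
  note b = assms(7) and t = assms(8)
  have ch: "chain_with_distribution (\<Omega> n) (K n) (\<pi> n)" if "n \<ge> 1" for n
    using assms(2,3)[OF that] by (simp add: chain_with_distribution_def stationary_distribution_def)
  have cont: "has_cutoff (\<lambda>n \<epsilon>. T_cont (\<Omega> n) (K n) (\<pi> n) \<epsilon>) t b \<longleftrightarrow>
      b \<in> o(t) \<and> (\<forall>\<epsilon>\<in>{0<..<1}. lower_window (?S \<epsilon>) t b \<and> upper_window (?S \<epsilon>) t b)"
    by (rule has_cutoff_iff_windows) (use b in \<open>simp_all add: T_cont_def cont_times_def\<close>)
  have lazy: "has_cutoff (\<lambda>n \<epsilon>. T_lazy (\<Omega> n) (K n) (\<pi> n) \<delta> \<epsilon>) (\<lambda>n. t n / (1 - \<delta>)) b \<longleftrightarrow>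
      b \<in> o(\<lambda>n. t n / (1 - \<delta>)) \<and> (\<forall>\<epsilon>\<in>{0<..<1}. lower_window (?L \<delta> \<epsilon>) (\<lambda>n. t n / (1 - \<delta>)) b \<and>
        upper_window (?L \<delta> \<epsilon>) (\<lambda>n. t n / (1 - \<delta>)) b)" for \<delta>
    by (rule has_cutoff_iff_windows) (use b in \<open>simp_all add: T_lazy_def lazy_times_def image_image\<close>)
  have o_iff: "b \<in> o(\<lambda>n. t n / (1 - \<delta>)) \<longleftrightarrow> b \<in> o(t)" if "\<delta> < 1" for \<delta>
    using that by simp
  show ?thesis
  proof
    assume "has_cutoff (\<lambda>n \<epsilon>. T_cont (\<Omega> n) (K n) (\<pi> n) \<epsilon>) t b"
    then have o: "b \<in> o(t)" and low: "\<And>\<epsilon>. \<epsilon> \<in> {0<..<1} \<Longrightarrow> lower_window (?S \<epsilon>) t b"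
      and up: "\<And>\<epsilon>. \<epsilon> \<in> {0<..<1} \<Longrightarrow> upper_window (?S \<epsilon>) t b" unfolding cont by auto
    \<comment> \<open>Going back in time by \<open>1/4\<close> raises the level from \<open>1/4\<close> to \<open>1/2\<close>.\<close>
    have "s - 1 / 4 \<in> ?S (1 / 2) n" if "n \<ge> 1" "s \<in> ?S (1 / 4) n" "1 / 4 \<le> s" for n s
    proof -
      interpret chain_with_distribution "\<Omega> n" "K n" "\<pi> n" by (rule ch[OF that(1)])
      show ?thesis using that d_cont_Lipschitz[of "1 / 4" s "1 / 4"] by (simp add: cont_times_def)
    qed
    then obtain c where c: "0 < c" "\<forall>\<^sub>F n in sequentially. c \<le> b n"
      using window_bounded_below[OF o t b low[of "1 / 4"] up[of "1 / 4"] low[of "1 / 2"], of "1 / 4"] by force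
    show "\<forall>\<delta>\<in>{0<..<1}. has_cutoff (\<lambda>n \<epsilon>. T_lazy (\<Omega> n) (K n) (\<pi> n) \<delta> \<epsilon>) (\<lambda>n. t n / (1 - \<delta>)) b"
    proof
      fix \<delta> :: real assume "\<delta> \<in> {0<..<1}"
      then have \<delta>: "0 < \<delta>" "\<delta> < 1" and p: "0 < 1 - \<delta>" by auto
      have "lower_window (?L \<delta> \<epsilon>) (\<lambda>n. t n / (1 - \<delta>)) b \<and> upper_window (?L \<delta> \<epsilon>) (\<lambda>n. t n / (1 - \<delta>)) b"
        if "\<epsilon> \<in> {0<..<1}" for \<epsilon>
      proof
        have \<epsilon>: "0 < \<epsilon>" "\<epsilon> < 1" using that by auto
        obtain \<kappa> where \<kappa>: "0 < \<kappa>" "\<kappa> < 1" and far: "\<And>(\<Omega> :: 'a set) K \<pi> m. chain_with_distribution \<Omega> K \<pi> \<Longrightarrow>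
            d_lazy \<Omega> K \<pi> \<delta> m \<le> \<epsilon> \<Longrightarrow> d_cont \<Omega> K \<pi> ((1 - \<delta>) * real m) \<le> 1 - \<kappa>"
          using d_cont_not_near_one_if_d_lazy[OF \<delta> \<epsilon>(2), where 'a = 'a] by blast
        show "lower_window (?L \<delta> \<epsilon>) (\<lambda>n. t n / (1 - \<delta>)) b"
        proof (rule lower_window_transfer[OF low[of "1 - \<kappa>"] c p order_refl])
          fix n s' assume n: "n \<ge> 1" "s' \<in> ?L \<delta> \<epsilon> n"
          then obtain m where m: "s' = real m" "d_lazy (\<Omega> n) (K n) (\<pi> n) \<delta> m \<le> \<epsilon>"
            by (auto simp: lazy_times_def)
          show "\<exists>s\<in>?S (1 - \<kappa>) n. s \<le> (1 - \<delta>) * s' + 0"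
            using far[OF ch[OF n(1)] m(2)] m(1) p
            by (intro bexI[of _ "(1 - \<delta>) * real m"]) (auto simp: cont_times_def)
        qed (use \<kappa> in auto)
        obtain \<eta>0 where \<eta>0: "0 < \<eta>0" and small: "\<And>(\<Omega> :: 'a set) K \<pi> m. chain_with_distribution \<Omega> K \<pi> \<Longrightarrow>
            d_cont \<Omega> K \<pi> ((1 - \<delta>) * real m) \<le> \<eta>0 \<Longrightarrow> d_lazy \<Omega> K \<pi> \<delta> m \<le> \<epsilon>"
          using d_lazy_small_if_d_cont_small[OF \<delta> \<epsilon>(1), where 'a = 'a] by blast
        \<comment> \<open>The cutoff property speaks about levels below \<open>1\<close> only.\<close>
        define \<eta> where "\<eta> = min \<eta>0 (1 / 2)"
        have \<eta>: "\<eta> \<in> {0<..<1}" "\<eta> \<le> \<eta>0" using \<eta>0 by (auto simp: \<eta>_def)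
        have "upper_window (?L \<delta> \<epsilon>) (\<lambda>n. 1 / (1 - \<delta>) * t n) b"
        proof (rule upper_window_transfer[OF up[OF \<eta>(1)] c _ zero_le_one])
          fix n s assume n: "n \<ge> 1" and "s \<in> ?S \<eta> n"
          then have s: "0 \<le> s" "d_cont (\<Omega> n) (K n) (\<pi> n) s \<le> \<eta>0" using \<eta> by (auto simp: cont_times_def)
          interpret chain_with_distribution "\<Omega> n" "K n" "\<pi> n" by (rule ch[OF n])
          let ?m = "nat \<lceil>s / (1 - \<delta>)\<rceil>"
          note m = nat_ceiling_divide_bounds[OF p s(1)]
          have "d_lazy (\<Omega> n) (K n) (\<pi> n) \<delta> ?m \<le> \<epsilon>"
            by (rule small[OF ch[OF n] d_cont_mono[OF s(1) m(1) s(2)]])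
          then show "\<exists>s'\<in>?L \<delta> \<epsilon> n. s' \<le> 1 / (1 - \<delta>) * s + 1"
            using m(2) by (auto simp: lazy_times_def)
        qed (use p in simp)
        then show "upper_window (?L \<delta> \<epsilon>) (\<lambda>n. t n / (1 - \<delta>)) b" by simp
      qed
      then show "has_cutoff (\<lambda>n \<epsilon>. T_lazy (\<Omega> n) (K n) (\<pi> n) \<delta> \<epsilon>) (\<lambda>n. t n / (1 - \<delta>)) b"
        unfolding lazy o_iff[OF \<delta>(2)] using o by blast
    qed
  next
    assume all: "\<forall>\<delta>\<in>{0<..<1}. has_cutoff (\<lambda>n \<epsilon>. T_lazy (\<Omega> n) (K n) (\<pi> n) \<delta> \<epsilon>) (\<lambda>n. t n / (1 - \<delta>)) b"
    have low: "lower_window (?L \<delta> \<epsilon>) (\<lambda>n. t n / (1 - \<delta>)) b"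
      and up: "upper_window (?L \<delta> \<epsilon>) (\<lambda>n. t n / (1 - \<delta>)) b"
      and o: "b \<in> o(\<lambda>n. t n / (1 - \<delta>))"
      if "0 < \<delta>" "\<delta> < 1" "0 < \<epsilon>" "\<epsilon> < 1" for \<delta> \<epsilon>
      using all that unfolding lazy by simp_all
    have ot: "b \<in> o(t)" using o[of "1 / 2" "1 / 2"] by simp
    \<comment> \<open>Laziness \<open>3/4\<close> makes one step back raise the level by \<open>1/4\<close>.\<close>
    have "s - 1 \<in> ?L (3 / 4) (1 / 2) n" if n: "n \<ge> 1" and s: "s \<in> ?L (3 / 4) (1 / 4) n" "1 \<le> s" for n s
    proof -
      interpret chain_with_distribution "\<Omega> n" "K n" "\<pi> n" by (rule ch[OF n])
      obtain m where m: "s = real m" "d_lazy (\<Omega> n) (K n) (\<pi> n) (3 / 4) m \<le> 1 / 4"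
        using s(1) by (auto simp: lazy_times_def)
      then obtain k where k: "m = Suc k" using s(2) by (cases m) auto
      have "d_lazy (\<Omega> n) (K n) (\<pi> n) (3 / 4) k \<le> 1 / 2"
        using d_lazy_Suc_le[of "3 / 4" k "1 / 4"] m k by simp
      then show ?thesis using m k by (auto simp: lazy_times_def)
    qed
    moreover have "filterlim (\<lambda>n. t n / (1 - 3 / 4)) at_top sequentially"
      using filterlim_tendsto_pos_mult_at_top[OF tendsto_const[of 4] _ t] by (simp add: mult.commute)
    ultimately obtain c where c: "0 < c" "\<forall>\<^sub>F n in sequentially. c \<le> b n"
      using window_bounded_below[OF o[of "3 / 4" "1 / 2"] _ b low[of "3 / 4" "1 / 4"] up[of "3 / 4" "1 / 4"]
          low[of "3 / 4" "1 / 2"], of 1] by force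
    have "lower_window (?S \<epsilon>) t b \<and> upper_window (?S \<epsilon>) t b" if "\<epsilon> \<in> {0<..<1}" for \<epsilon>
    proof
      have \<epsilon>: "0 < \<epsilon>" "\<epsilon> < 1" using that by auto
      \<comment> \<open>A laziness adapted to \<open>\<epsilon>\<close>: the comparison error must fit below \<open>\<epsilon>\<close> and below \<open>1 - \<epsilon>\<close>.\<close>
      obtain \<delta> where \<delta>: "0 < \<delta>" "\<delta> < 1"
        and E: "exp 1 * sqrt (1 - \<delta>) / (1 - sqrt (1 - \<delta>))\<^sup>2 \<le> min (\<epsilon> / 2) ((1 - \<epsilon>) / 2)"
        using lazy_error_small[of "min (\<epsilon> / 2) ((1 - \<epsilon>) / 2)"] \<epsilon> by auto
      have E1: "exp 1 * sqrt (1 - \<delta>) / (1 - sqrt (1 - \<delta>))\<^sup>2 \<le> \<epsilon> / 2"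
        and E2: "exp 1 * sqrt (1 - \<delta>) / (1 - sqrt (1 - \<delta>))\<^sup>2 \<le> (1 - \<epsilon>) / 2"
        using E by (simp_all only: min.bounded_iff)
      have p: "0 < 1 - \<delta>" using \<delta> by simp
      have "lower_window (?S \<epsilon>) (\<lambda>n. t n / (1 - \<delta>) / (1 / (1 - \<delta>))) b"
      proof (rule lower_window_transfer[OF low[OF \<delta>, of "(1 + \<epsilon>) / 2"] c _ zero_le_one])
        fix n s assume n: "n \<ge> 1" and "s \<in> ?S \<epsilon> n"
        then have s: "0 \<le> s" "d_cont (\<Omega> n) (K n) (\<pi> n) s \<le> \<epsilon>" by (auto simp: cont_times_def)
        interpret chain_with_distribution "\<Omega> n" "K n" "\<pi> n" by (rule ch[OF n])
        let ?m = "nat \<lceil>s / (1 - \<delta>)\<rceil>"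
        note m = nat_ceiling_divide_bounds[OF p s(1)]
        have "d_lazy (\<Omega> n) (K n) (\<pi> n) \<delta> ?m \<le> (1 + \<epsilon>) / 2"
          using d_lazy_le_d_cont[OF \<delta> d_cont_mono[OF s(1) m(1) s(2)]] E2 by argo
        then show "\<exists>s'\<in>?L \<delta> ((1 + \<epsilon>) / 2) n. s' \<le> 1 / (1 - \<delta>) * s + 1"
          using m(2) by (auto simp: lazy_times_def)
      qed (use \<epsilon> p in auto)
      then show "lower_window (?S \<epsilon>) t b" using p by simp
      have "upper_window (?S \<epsilon>) (\<lambda>n. (1 - \<delta>) * (t n / (1 - \<delta>))) b"
      proof (rule upper_window_transfer[OF up[OF \<delta>, of "\<epsilon> / 2"] c p order_refl])
        fix n s assume n: "n \<ge> 1" and "s \<in> ?L \<delta> (\<epsilon> / 2) n"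
        then obtain m where m: "s = real m" "d_lazy (\<Omega> n) (K n) (\<pi> n) \<delta> m \<le> \<epsilon> / 2"
          by (auto simp: lazy_times_def)
        interpret chain_with_distribution "\<Omega> n" "K n" "\<pi> n" by (rule ch[OF n])
        have "d_cont (\<Omega> n) (K n) (\<pi> n) ((1 - \<delta>) * real m) \<le> \<epsilon>"
          using d_cont_le_d_lazy[OF \<delta> m(2)] E1 by argo
        then show "\<exists>s'\<in>?S \<epsilon> n. s' \<le> (1 - \<delta>) * s + 0"
          using m(1) p by (intro bexI[of _ "(1 - \<delta>) * real m"]) (auto simp: cont_times_def)
      qed (use \<epsilon> in auto)
      then show "upper_window (?S \<epsilon>) t b" using p by simp
    qed
    then show "has_cutoff (\<lambda>n \<epsilon>. T_cont (\<Omega> n) (K n) (\<pi> n) \<epsilon>) t b"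
      unfolding cont using ot by blast
  qed
qed

end
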